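(* Let $(\sigma,\alpha)$ be a planar hypermap with directed medial map $M(\sigma,\alpha)=(\sigma',\alpha')$. Then, for every fixed positive integer $m$, $$m^{\kappa(\sigma,\alpha)}\,R(\sigma,\alpha;m,m)=\sum_{\lambda}\ \prod_{v\in\sigma'}\nu(v,\lambda),$$ where the summation runs over all Eulerian $m$-colorings $\lambda$ of the directed medial map $M(\sigma,\alpha)$, the product is over all vertices (cycles) $v$ of $\sigma'$, and $\nu(v,\lambda)$ is the valence of $v$ colored by the restriction to the points of $v$ of the point coloring induced by $\lambda$.
   Context: Permutations act on a finite set and are composed from right to left; $z(\pi)$ is the number of cycles of $\pi$ (fixed points included). A collection of hypermaps on $\{1,\ldots,n\}$ is an ordered pair $(\sigma,\alpha)$ of permutations; $\kappa(\sigma,\alpha)$ is the number of orbits of the group they generate; it is a hypermap if $\kappa(\sigma,\alpha)=1$. A hypermap is planar if its genus is $0$, where $n+2-2g(\sigma,\alpha)=z(\sigma)+z(\alpha)+z(\alpha^{-1}\sigma)$. A permutation $\beta$ is a refinement of $\alpha$ ($\beta\le\alpha$) if $\beta$ is obtained by replacing each cycle $\alpha_i$ of $\alpha$ by a permutation $\beta_i$ of the same $n_i$ points with $z(\beta_i)+z(\beta_i^{-1}\alpha_i)=n_i+1$. The Whitney polynomial is $$R(\sigma,\alpha;u,v)=\sum_{\beta\leq\alpha}u^{\kappa(\sigma,\beta)-\kappa(\sigma,\alpha)}\,v^{\kappa(\sigma,\beta)+n-z(\beta)-z(\sigma)}.$$ The medial map $M(\sigma,\alpha)=(\sigma',\alpha')$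 is the pair of permutations of $\{1^-,1^+,\ldots,n^-,n^+\}$ given by: the cycles of $\sigma'$ (vertices) are all cycles $(i_1^-,i_1^+,\ldots,i_k^-,i_k^+)$ where $(i_1,\ldots,i_k)$ is a cycle of $\alpha$; the cycles of $\alpha'$ (edges) are all $2$-cycles $(i^+,\sigma(i)^-)$, each directed from its positive to its negative endpoint. An Eulerian $m$-coloring of a directed Eulerian graph is an edge coloring with $m$ colors such that, for each color, the (possibly empty) set of edges of that color forms an Eulerian subdigraph (in-degree equals out-degree at every vertex). The point coloring induced by an Eulerian $m$-coloring of $M(\sigma,\alpha)$ gives both endpoints of each edge $(i^+,\sigma(i)^-)$ the color of that edge. A coherent matching of the points of a cycle $(i_1^-,i_1^+,\ldots,i_k^-,i_k^+)$ is a perfect matching of its points that matches positive points to negative points and is noncrossing with respect to the cyclic order. The valence of such a cycle with colored points is the number of coherent matchings of its points that match each point to a point of the same color. *)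

theory Defs
  imports
    Complex_Main
    "HOL-Library.FuncSet"
    "HOL-Library.Disjoint_Sets"
    "HOL-Combinatorics.Orbits"
    "HOL-Algebra.Sym_Groups"
    "Graph_Theory.Digraph"
begin

section \<open>Hypermaps\<close>

text \<open>A cycle of a permutation is represented by the set of its points; the cyclic order on
  it is given by the permutation.  A fixed point \<open>x\<close> has \<open>orbit f x = {x}\<close>.\<close>

definition perm_cycles :: "'a set \<Rightarrow> ('a \<Rightarrow> 'a) \<Rightarrow> 'a set set" where
  "perm_cycles S p = orbit p ` S"

definition num_cycles :: "'a set \<Rightarrow> ('a \<Rightarrow> 'a) \<Rightarrow> nat" where
  "num_cycles S p = card (perm_cycles S p)"

definition hypermap_collection :: "nat \<Rightarrow> (nat \<Rightarrow> nat) \<Rightarrow> (nat \<Rightarrow> nat) \<Rightarrow> bool" where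
  "hypermap_collection n \<sigma> \<alpha> \<longleftrightarrow> \<sigma> permutes {1..n} \<and> \<alpha> permutes {1..n}"

definition kappa :: "nat \<Rightarrow> (nat \<Rightarrow> nat) \<Rightarrow> (nat \<Rightarrow> nat) \<Rightarrow> nat" where
  "kappa n \<sigma> \<alpha> = card ((\<lambda>x. (\<lambda>g. g x) ` generate (sym_group n) {\<sigma>, \<alpha>}) ` {1..n})"

definition hypermap :: "nat \<Rightarrow> (nat \<Rightarrow> nat) \<Rightarrow> (nat \<Rightarrow> nat) \<Rightarrow> bool" where
  "hypermap n \<sigma> \<alpha> \<longleftrightarrow> hypermap_collection n \<sigma> \<alpha> \<and> kappa n \<sigma> \<alpha> = 1"

text \<open>The genus is real-valued, so that neither truncated subtraction nor rounding can turn a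
  nonzero genus into 0.\<close>

definition genus :: "nat \<Rightarrow> (nat \<Rightarrow> nat) \<Rightarrow> (nat \<Rightarrow> nat) \<Rightarrow> real" where
  "genus n \<sigma> \<alpha> =
     (real n + 2 - real (num_cycles {1..n} \<sigma>) - real (num_cycles {1..n} \<alpha>)
        - real (num_cycles {1..n} (inv' \<alpha> \<circ> \<sigma>))) / 2"

definition planar_hypermap :: "nat \<Rightarrow> (nat \<Rightarrow> nat) \<Rightarrow> (nat \<Rightarrow> nat) \<Rightarrow> bool" where
  "planar_hypermap n \<sigma> \<alpha> \<longleftrightarrow> hypermap n \<sigma> \<alpha> \<and> genus n \<sigma> \<alpha> = 0"


section \<open>Refinements and the Whitney polynomial\<close>

text \<open>\<open>C\<close> ranges over the cycles of \<open>\<alpha>\<close>; \<open>perm_restrict \<alpha> C\<close> is the cycle \<open>\<alpha>\<^sub>i\<close> and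
  \<open>perm_restrict \<beta> C\<close> the permutation \<open>\<beta>\<^sub>i\<close> replacing it.\<close>

definition refines :: "nat \<Rightarrow> (nat \<Rightarrow> nat) \<Rightarrow> (nat \<Rightarrow> nat) \<Rightarrow> bool" where
  "refines n \<beta> \<alpha> \<longleftrightarrow>
     \<beta> permutes {1..n} \<and>
     (\<forall>C \<in> perm_cycles {1..n} \<alpha>.
        perm_restrict \<beta> C permutes C \<and>
        num_cycles C (perm_restrict \<beta> C)
          + num_cycles C (inv' (perm_restrict \<beta> C) \<circ> perm_restrict \<alpha> C) = card C + 1)"

definition whitney ::
  "nat \<Rightarrow> (nat \<Rightarrow> nat) \<Rightarrow> (nat \<Rightarrow> nat) \<Rightarrow> 'a::field \<Rightarrow> 'a \<Rightarrow> 'a" where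
  "whitney n \<sigma> \<alpha> u v =
     (\<Sum>\<beta> | refines n \<beta> \<alpha>.
        u powi (int (kappa n \<sigma> \<beta>) - int (kappa n \<sigma> \<alpha>)) *
        v powi (int (kappa n \<sigma> \<beta>) + int n
                  - int (num_cycles {1..n} \<beta>) - int (num_cycles {1..n} \<sigma>)))"


section \<open>The directed medial map\<close>

text \<open>\<open>Neg i\<close> and \<open>Pos i\<close> stand for \<open>i\<^sup>-\<close> and \<open>i\<^sup>+\<close>.\<close>

datatype medial_point = Neg nat | Pos nat

definition medial_points :: "nat \<Rightarrow> medial_point set" where
  "medial_points n = Neg ` {1..n} \<union> Pos ` {1..n}"

fun medial_vertex_perm :: "nat \<Rightarrow> (nat \<Rightarrow> nat) \<Rightarrow> medial_point \<Rightarrow> medial_point" where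
  "medial_vertex_perm n \<alpha> (Neg i) = (if i \<in> {1..n} then Pos i else Neg i)"
| "medial_vertex_perm n \<alpha> (Pos i) = (if i \<in> {1..n} then Neg (\<alpha> i) else Pos i)"

fun medial_edge_perm :: "nat \<Rightarrow> (nat \<Rightarrow> nat) \<Rightarrow> medial_point \<Rightarrow> medial_point" where
  "medial_edge_perm n \<sigma> (Pos i) = (if i \<in> {1..n} then Neg (\<sigma> i) else Pos i)"
| "medial_edge_perm n \<sigma> (Neg j) = (if j \<in> {1..n} then Pos (inv' \<sigma> j) else Neg j)"

definition medial_map ::
  "nat \<Rightarrow> (nat \<Rightarrow> nat) \<Rightarrow> (nat \<Rightarrow> nat) \<Rightarrow>
     (medial_point \<Rightarrow> medial_point) \<times> (medial_point \<Rightarrow> medial_point)" where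
  "medial_map n \<sigma> \<alpha> = (medial_vertex_perm n \<alpha>, medial_edge_perm n \<sigma>)"

text \<open>The underlying directed graph of a medial map \<open>(\<sigma>', \<alpha>')\<close>: its vertices are the cycles of
  \<open>\<sigma>'\<close>, its arcs the 2-cycles of \<open>\<alpha>'\<close>, and an arc leaves the vertex containing its positive
  endpoint and enters the vertex containing its negative endpoint.\<close>

definition medial_digraph ::
  "nat \<Rightarrow> (medial_point \<Rightarrow> medial_point) \<times> (medial_point \<Rightarrow> medial_point) \<Rightarrow>
     (medial_point set, medial_point set) pre_digraph" where
  "medial_digraph n M =
     (case M of (\<sigma>', \<alpha>') \<Rightarrow>
       \<lparr> verts = perm_cycles (medial_points n) \<sigma>',
         arcs = perm_cycles (medial_points n) \<alpha>',
         tail = (\<lambda>e. orbit \<sigma>' (THE p. p \<in> e \<and> p \<in> range Pos)),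
         head = (\<lambda>e. orbit \<sigma>' (THE p. p \<in> e \<and> p \<in> range Neg)) \<rparr>)"


section \<open>Eulerian colorings\<close>

definition eulerian_digraph :: "('a, 'b) pre_digraph \<Rightarrow> bool" where
  "eulerian_digraph G \<longleftrightarrow> (\<forall>v \<in> verts G. in_degree G v = out_degree G v)"

text \<open>Colorings are extensional functions, so that each coloring of the arcs is represented by
  exactly one function.\<close>

definition eulerian_colorings :: "nat \<Rightarrow> ('a, 'b) pre_digraph \<Rightarrow> ('b \<Rightarrow> nat) set" where
  "eulerian_colorings m G =
     {col \<in> arcs G \<rightarrow>\<^sub>E {1..m}.
        \<forall>c \<in> {1..m}. eulerian_digraph (G\<lparr>arcs := {e \<in> arcs G. col e = c}\<rparr>)}"

text \<open>The edge with endpoint \<open>p\<close> is the cycle of \<open>\<alpha>'\<close> through \<open>p\<close>.\<close>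

definition induced_coloring ::
  "(medial_point \<Rightarrow> medial_point) \<Rightarrow> (medial_point set \<Rightarrow> nat) \<Rightarrow> medial_point \<Rightarrow> nat" where
  "induced_coloring \<alpha>' col p = col (orbit \<alpha>' p)"


section \<open>Coherent matchings and valence\<close>

text \<open>Two pairs cross iff, for some point \<open>a\<close>, they are \<open>{a, c}\<close> and \<open>{b, d}\<close> where \<open>a, b, c, d\<close> are
  distinct points met in this order when following the cycle \<open>v\<close> of \<open>s\<close> once around from \<open>a\<close>.\<close>

definition noncrossing :: "('a \<Rightarrow> 'a) \<Rightarrow> 'a set \<Rightarrow> 'a set set \<Rightarrow> bool" where
  "noncrossing s v P \<longleftrightarrow>
     \<not> (\<exists>a \<in> v. \<exists>i j k. 0 < i \<and> i < j \<and> j < k \<and> k < card v \<and>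
          {a, (s ^^ j) a} \<in> P \<and> {(s ^^ i) a, (s ^^ k) a} \<in> P)"

definition coherent_matching ::
  "(medial_point \<Rightarrow> medial_point) \<Rightarrow> medial_point set \<Rightarrow> medial_point set set \<Rightarrow> bool" where
  "coherent_matching \<sigma>' v P \<longleftrightarrow>
     partition_on v P \<and> (\<forall>e \<in> P. \<exists>i j. e = {Pos i, Neg j}) \<and> noncrossing \<sigma>' v P"

definition valence ::
  "(medial_point \<Rightarrow> medial_point) \<Rightarrow> medial_point set \<Rightarrow> (medial_point \<Rightarrow> nat) \<Rightarrow> nat" where
  "valence \<sigma>' v pcol =
     card {P. coherent_matching \<sigma>' v P \<and> (\<forall>e \<in> P. \<forall>p \<in> e. \<forall>q \<in> e. pcol p = pcol q)}"

end

theory Submission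
  imports Defs
begin

text \<open>A permutation \<open>\<beta>\<close> of the points of a cycle of \<open>\<alpha>\<close> gives the matching
  \<open>{Pos i, Neg (\<beta> i)}\<close> of the corresponding medial vertex. Composing the rotation around the
  vertex with this matching yields a copy of \<open>\<beta>\<close> on the positive points and a conjugate of
  \<open>\<beta>\<inverse>\<alpha>\<close> on the negative ones; since a perfect matching is noncrossing exactly when
  multiplying by its pairs always splits a cycle, coherent matchings correspond to refinements. An
  edge coloring is compatible with the matchings given by \<open>\<beta>\<close> iff it is constant on the cycles of
  \<open>\<sigma>\<inverse>\<beta>\<close>, and it is then Eulerian. So the right-hand side is the sum of
  \<open>m^z(\<sigma>\<inverse>\<beta>)\<close> over all refinements \<open>\<beta>\<close>. This agrees with the Whitney polynomial because
  \<open>(\<sigma>, \<beta>)\<close> again has genus 0: \<open>\<beta>\<close> arises from \<open>\<alpha>\<close> by transpositions that each split a cycle of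
  the second permutation, and such a step cannot increase the genus.\<close>

section \<open>Connected components and cycles\<close>

text \<open>Give a permutation the length \<open>card S - num_cycles S f\<close>, its distance from
  the identity in transpositions. Refinement then says that \<beta> lies, on each cycle of \<alpha>,
  on a geodesic from the identity to \<alpha>, and coherence of a matching says that a cycle count
  is as large as possible. Both rest on one fact: composing with the transposition of
  \<open>a\<close> and \<open>b\<close> splits their cycle if they share one and merges their cycles
  otherwise. It is read off from connectivity, since the graphs before and after agree once an edge
  \<open>(a, b)\<close> is added. The obstacle is that the group generated by \<sigma> and \<beta>
  need not be transitive. Genus 0 has to be stated for several components, with
  \<open>2 * kappa\<close> in place of 2. A component that falls apart adds 2 to this expression,
  and the two cycle counts must pay for it. They do, because \<open>a\<close> and \<open>b\<close>
  can become disconnected only if the cycle of the product splits as well. Solving genus 0 for the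
  number of cycles of the product gives exactly the exponent of \<open>m\<close> on the left-hand
  side.\<close>

definition conn :: "('a \<times> 'a) set \<Rightarrow> ('a \<times> 'a) set" where
  "conn R = (R \<union> R\<inverse>)\<^sup>*"

text \<open>The graph lives on the whole type, where a permutation of \<open>S\<close> only adds
  loops outside \<open>S\<close>. Cycles of one permutation and orbits of the group generated by two
  are then components of a graph and of a union of graphs.\<close>

definition fun_graph :: "('a \<Rightarrow> 'a) \<Rightarrow> ('a \<times> 'a) set" where
  "fun_graph f = {(x, f x) | x. True}"

definition num_comps :: "'a set \<Rightarrow> ('a \<times> 'a) set \<Rightarrow> nat" where
  "num_comps S R = card ((\<lambda>x. conn R `` {x}) ` S)"

lemma conn_refl [simp]: "(x, x) \<in> conn R"
  by (simp add: conn_def)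

lemma conn_sym: "(x, y) \<in> conn R \<Longrightarrow> (y, x) \<in> conn R"
proof -
  have "sym (R \<union> R\<inverse>)" by (auto simp: sym_def)
  then show "(x, y) \<in> conn R \<Longrightarrow> (y, x) \<in> conn R"
    unfolding conn_def by (meson sym_rtrancl symD)
qed

lemma conn_trans: "(x, y) \<in> conn R \<Longrightarrow> (y, z) \<in> conn R \<Longrightarrow> (x, z) \<in> conn R"
  unfolding conn_def by simp

lemma equiv_conn: "equiv UNIV (conn R)"
proof (rule equivI)
  show "refl (conn R)" by (simp add: refl_on_def)
  show "sym (conn R)" by (rule symI) (rule conn_sym)
  show "trans (conn R)" by (rule transI) (rule conn_trans)
qed simp

lemma conn_Image_eq_iff: "conn R `` {x} = conn R `` {y} \<longleftrightarrow> (x, y) \<in> conn R"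
  using equiv_class_eq_iff[OF equiv_conn, of x y R] by simp

lemma conn_incl: "p \<in> R \<Longrightarrow> p \<in> conn R"
  unfolding conn_def by auto

lemma conn_induct [consumes 1, case_names refl step converse_step]:
  assumes "(x, y) \<in> conn R" "P x"
    and "\<And>y z. (x, y) \<in> conn R \<Longrightarrow> P y \<Longrightarrow> (y, z) \<in> R \<Longrightarrow> P z"
    and "\<And>y z. (x, y) \<in> conn R \<Longrightarrow> P y \<Longrightarrow> (z, y) \<in> R \<Longrightarrow> P z"
  shows "P y"
  using assms(1) unfolding conn_def
proof (induction rule: rtrancl_induct)
  case (step y z)
  then show ?case using assms(3)[of y z] assms(4)[of y z] by (auto simp: conn_def)
qed (rule assms(2))

lemma conn_subsetI:
  assumes "R \<subseteq> conn R'"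
  shows "conn R \<subseteq> conn R'"
proof (rule subrelI)
  fix x y assume "(x, y) \<in> conn R"
  then show "(x, y) \<in> conn R'"
  proof (induction rule: conn_induct)
    case (step y z)
    then show ?case using assms by (meson conn_trans subsetD)
  next
    case (converse_step y z)
    then show ?case using assms by (meson conn_trans conn_sym subsetD)
  qed simp
qed

lemma conn_mono: "R \<subseteq> R' \<Longrightarrow> conn R \<subseteq> conn R'"
  by (rule conn_subsetI) (auto intro: conn_incl)

text \<open>A shortest connecting path uses the added edge at most once, in one of its two
  directions.\<close>

lemma conn_insert:
  "(x, y) \<in> conn (insert (a, b) R) \<longleftrightarrow>
     (x, y) \<in> conn R \<or> (x, a) \<in> conn R \<and> (b, y) \<in> conn R \<or> (x, b) \<in> conn R \<and> (a, y) \<in> conn R"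
proof
  assume "(x, y) \<in> conn (insert (a, b) R)"
  then show "(x, y) \<in> conn R \<or> (x, a) \<in> conn R \<and> (b, y) \<in> conn R \<or>
      (x, b) \<in> conn R \<and> (a, y) \<in> conn R"
  proof (induction rule: conn_induct)
    case (step y z)
    then show ?case
      using conn_incl[of "(y, z)" R] by (elim insertE) (auto intro: conn_trans)
  next
    case (converse_step y z)
    then show ?case
      using conn_incl[of "(z, y)" R] conn_sym[of z y R] by (elim insertE) (auto intro: conn_trans)
  qed simp
next
  have "conn R \<subseteq> conn (insert (a, b) R)" by (rule conn_mono) auto
  moreover have "(a, b) \<in> conn (insert (a, b) R)" by (rule conn_incl) simp
  ultimately show "(x, y) \<in> conn R \<or> (x, a) \<in> conn R \<and> (b, y) \<in> conn R \<or>
      (x, b) \<in> conn R \<and> (a, y) \<in> conn R \<Longrightarrow> (x, y) \<in> conn (insert (a, b) R)"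
    by (meson conn_sym conn_trans subsetD)
qed

lemma num_comps_insert:
  assumes "finite S" "a \<in> S" "b \<in> S"
  shows "num_comps S R = num_comps S (insert (a, b) R) + (if (a, b) \<in> conn R then 0 else 1)"
proof (cases "(a, b) \<in> conn R")
  case True
  then have "conn (insert (a, b) R) = conn R"
    by (auto simp: conn_insert) (meson conn_sym conn_trans)+
  with True show ?thesis by (simp add: num_comps_def)
next
  case False
  let ?A = "conn R `` {a}" and ?B = "conn R `` {b}"
  let ?cl = "\<lambda>x. conn R `` {x}" and ?cl' = "\<lambda>x. conn (insert (a, b) R) `` {x}"
  have "(x, y) \<in> conn (insert (a, b) R) \<longleftrightarrow> (if (a, x) \<in> conn R \<or> (b, x) \<in> conn R
      then (a, y) \<in> conn R \<or> (b, y) \<in> conn R else (x, y) \<in> conn R)" for x y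
    unfolding conn_insert by (smt (verit) conn_sym conn_trans)
  then have cl': "?cl' x = (if x \<in> ?A \<union> ?B then ?A \<union> ?B else ?cl x)" for x by auto
  have mem: "x \<in> ?cl x" for x by simp
  have eqA: "x \<in> ?A \<longleftrightarrow> ?cl x = ?A" and eqB: "x \<in> ?B \<longleftrightarrow> ?cl x = ?B" for x
    using conn_Image_eq_iff conn_sym by (metis Image_singleton_iff)+
  have AB: "?A \<noteq> ?B" using False by (simp add: conn_Image_eq_iff)
  \<comment> \<open>The fused class must be new, so that inserting it below raises the cardinality
    by one.\<close>
  have un: "?A \<union> ?B \<notin> ?cl ` S"
  proof
    assume "?A \<union> ?B \<in> ?cl ` S"
    then obtain x where x: "?A \<union> ?B = ?cl x" by blast
    then have "(x, a) \<in> conn R" "(x, b) \<in> conn R" using mem[of a] mem[of b] by blast+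
    then show False using False conn_sym conn_trans by metis
  qed
  have eq: "?cl' ` S = insert (?A \<union> ?B) (?cl ` S - {?A, ?B})"
  proof
    show "?cl' ` S \<subseteq> insert (?A \<union> ?B) (?cl ` S - {?A, ?B})"
      unfolding cl' using eqA eqB by auto
    show "insert (?A \<union> ?B) (?cl ` S - {?A, ?B}) \<subseteq> ?cl' ` S"
    proof
      fix X assume "X \<in> insert (?A \<union> ?B) (?cl ` S - {?A, ?B})"
      then consider "X = ?A \<union> ?B" | x where "x \<in> S" "X = ?cl x" "X \<noteq> ?A" "X \<noteq> ?B" by blast
      then show "X \<in> ?cl' ` S"
      proof cases
        case 1
        then have "X = ?cl' a" unfolding cl' by simp
        then show ?thesis using assms(2) by (rule image_eqI)
      next
        case 2
        then have "X = ?cl' x" unfolding cl' using eqA eqB by simp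
        then show ?thesis using 2(1) by (rule image_eqI)
      qed
    qed
  qed
  have "card (?cl' ` S) = Suc (card (?cl ` S - {?A, ?B}))"
    unfolding eq using un assms(1) by simp
  also have "card (?cl ` S - {?A, ?B}) = card (?cl ` S) - 2"
    using assms AB by (subst card_Diff_subset) auto
  also have "card (?cl ` S) \<ge> 2"
    using card_mono[of "?cl ` S" "{?A, ?B}"] assms AB by auto
  then have "Suc (card (?cl ` S) - 2) + 1 = card (?cl ` S)" by linarith
  finally show ?thesis using False by (simp add: num_comps_def)
qed

text \<open>Connectivity also permits backward steps. On a finite cycle these are forward steps in
  disguise, since going around returns to the predecessor.\<close>

lemma orbit_eq_conn:
  assumes "f permutes S" "finite S"
  shows "orbit f x = conn (fun_graph f) `` {x}"
proof -
  have perm: "permutation f" using assms permutation_permutes by blast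
  have "(x, y) \<in> conn (fun_graph f)" if "y \<in> orbit f x" for y
    using that
  proof induction
    case base
    show ?case by (rule conn_incl) (auto simp: fun_graph_def)
  next
    case (step y)
    have "(y, f y) \<in> conn (fun_graph f)" by (rule conn_incl) (auto simp: fun_graph_def)
    with step show ?case by (blast intro: conn_trans)
  qed
  moreover have "y \<in> orbit f x" if "(x, y) \<in> conn (fun_graph f)" for y
    using that
  proof (induction rule: conn_induct)
    case refl
    show ?case using perm by (rule permutation_self_in_orbit)
  next
    case (step y z)
    then show ?case by (auto simp: fun_graph_def intro: orbit.step)
  next
    case (converse_step y z)
    then have "y = f z" by (auto simp: fun_graph_def)
    then have "z \<in> orbit f y"
      using permutation_orbit_step[OF perm] permutation_self_in_orbit[OF perm] by metis
    then show ?case using converse_step by (blast intro: orbit_trans)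
  qed
  ultimately show ?thesis by auto
qed

lemma num_cycles_eq_num_comps:
  assumes "f permutes S" "finite S"
  shows "num_cycles S f = num_comps S (fun_graph f)"
  by (simp add: num_cycles_def perm_cycles_def num_comps_def orbit_eq_conn[OF assms])

text \<open>With the edge \<open>(a, b)\<close> present, the detour through the transposition stays
  inside a component. The relation \<open>R\<close> is empty for a single permutation and
  \<open>fun_graph \<sigma>\<close> for a pair.\<close>

lemma conn_transpose:
  "conn (insert (a, b) (fun_graph (f \<circ> transpose a b) \<union> R)) = conn (insert (a, b) (fun_graph f \<union> R))"
proof -
  have *: "conn (insert (a, b) (fun_graph (f \<circ> transpose a b) \<union> R)) \<subseteq> conn (insert (a, b) (fun_graph f \<union> R))" for f :: "'a \<Rightarrow> 'a"
  proof (rule conn_subsetI, rule subrelI)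
    let ?E = "conn (insert (a, b) (fun_graph f \<union> R))"
    fix x y assume "(x, y) \<in> insert (a, b) (fun_graph (f \<circ> transpose a b) \<union> R)"
    moreover have "(x, f (transpose a b x)) \<in> ?E"
    proof -
      have "(a, b) \<in> ?E" by (rule conn_incl) simp
      then have "(x, transpose a b x) \<in> ?E"
        by (auto simp: transpose_def intro: conn_sym)
      moreover have "(transpose a b x, f (transpose a b x)) \<in> ?E"
        by (rule conn_incl) (auto simp: fun_graph_def)
      ultimately show ?thesis by (rule conn_trans)
    qed
    ultimately show "(x, y) \<in> ?E"
      by (auto simp: fun_graph_def intro: conn_incl)
  qed
  have "f \<circ> transpose a b \<circ> transpose a b = f" by (simp add: comp_assoc)
  with *[of "f \<circ> transpose a b"] *[of f] show ?thesis by auto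
qed

section \<open>Cycles under composition with a transposition\<close>

lemma orbit_escape:
  assumes "x \<in> orbit g x" "x \<notin> A" "g x \<in> A" "\<And>y. y \<in> A \<Longrightarrow> y \<noteq> c \<Longrightarrow> g y \<in> A"
  shows "c \<in> orbit g x"
proof (rule ccontr)
  assume c: "c \<notin> orbit g x"
  \<comment> \<open>An orbit that avoids \<open>c\<close> is trapped in \<open>A\<close> after its
    first step and cannot return to \<open>x\<close>.\<close>
  have "y \<in> A" if "y \<in> orbit g x" for y
    using that
  proof induction
    case (step y)
    then show ?case using assms(4)[of y] c by auto
  qed (rule assms(3))
  with assms(1,2) show False by blast
qed

text \<open>The transposition redirects the last point \<open>(f ^^ j) a\<close> to
  \<open>f a\<close>, so the arc from \<open>f a\<close> to \<open>(f ^^ j) a\<close> closes up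
  without \<open>a\<close>. The same arc later separates the ends of a crossing pair.\<close>

lemma funpow_transpose_invariant:
  assumes "\<And>i. 0 < i \<Longrightarrow> i \<le> j \<Longrightarrow> (f ^^ i) a \<noteq> a" and inj: "inj_on (\<lambda>i. (f ^^ i) a) {1..j}"
    and "0 < i" "i \<le> j" "y \<in> orbit (f \<circ> transpose a ((f ^^ j) a)) ((f ^^ i) a)"
  shows "\<exists>l. 0 < l \<and> l \<le> j \<and> y = (f ^^ l) a"
proof -
  let ?g = "f \<circ> transpose a ((f ^^ j) a)"
  have next_power: "\<exists>l'. 0 < l' \<and> l' \<le> j \<and> ?g ((f ^^ l) a) = (f ^^ l') a" if "0 < l" "l \<le> j" for l
  proof (cases "l = j")
    case True
    then show ?thesis using that by (intro exI[of _ 1]) auto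
  next
    case False
    then have "(f ^^ l) a \<noteq> (f ^^ j) a"
      using inj_onD[OF inj, of l j] that by auto
    moreover have "(f ^^ l) a \<noteq> a" using assms(1) that by blast
    ultimately show ?thesis using that False by (intro exI[of _ "Suc l"]) auto
  qed
  show ?thesis using assms(5)
  proof induction
    case base
    show ?case using next_power[OF assms(3,4)] by metis
  next
    case (step y)
    then obtain l where "0 < l" "l \<le> j" "y = (f ^^ l) a" by blast
    then show ?case using next_power[of l] by metis
  qed
qed

lemma orbit_transpose_iff:
  assumes "f permutes S" "finite S" "a \<in> S" "b \<in> S" "a \<noteq> b"
  shows "b \<in> orbit f a \<longleftrightarrow> b \<notin> orbit (f \<circ> transpose a b) a"
proof -
  let ?g = "f \<circ> transpose a b"
  have g: "?g permutes S"
    using assms by (intro permutes_compose permutes_swap_id)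
  have perm: "permutation f" "permutation ?g" using assms(1,2) g permutation_permutes by blast+
  note self = permutation_self_in_orbit[OF perm(1)] permutation_self_in_orbit[OF perm(2)]
  show ?thesis
  proof
    assume b: "b \<in> orbit f a"
    define j where "j = funpow_dist f a b"
    have jb: "(f ^^ j) a = b" unfolding j_def using b by (rule funpow_dist_prop)
    have j0: "0 < j" using jb assms(5) by (cases j) auto
    note inj = inj_on_funpow_dist[OF b, folded j_def]
    have ne: "(f ^^ i) a \<noteq> a" if "0 < i" "i \<le> j" for i
      using inj_onD[OF inj, of i 0] that by auto
    have "inj_on (\<lambda>i. (f ^^ i) a) {1..j}" using inj by (rule inj_on_subset) auto
    note inv = funpow_transpose_invariant[OF ne this j0 order_refl, unfolded jb]
    have "a \<notin> orbit ?g b" using inv ne by metis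
    then show "b \<notin> orbit ?g a" using self(2) by (metis orbit_swap)
  next
    assume "b \<notin> orbit ?g a"
    then have *: "a \<notin> orbit ?g b" using self(2) by (metis orbit_swap)
    show "b \<in> orbit f a"
    proof (rule ccontr)
      assume nb: "b \<notin> orbit f a"
      \<comment> \<open>The first step from \<open>b\<close> enters the old cycle of
        \<open>a\<close>, which can only be left through \<open>a\<close>.\<close>
      have "a \<in> orbit ?g b"
      proof (rule orbit_escape[where A = "orbit f a"])
        show "?g b \<in> orbit f a" by (simp add: orbit.base)
        fix y assume "y \<in> orbit f a" "y \<noteq> a"
        moreover from this nb have "y \<noteq> b" by blast
        ultimately show "?g y \<in> orbit f a" by (simp add: orbit.step)
      qed (use nb self in auto)
      with * show False by blast
    qed
  qed
qed

text \<open>Adding the edge \<open>(a, b)\<close> makes both graphs have the same components, and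
  exactly one of them had \<open>a\<close> and \<open>b\<close> connected before. So the counts
  differ by exactly one.\<close>

lemma num_cycles_transpose:
  assumes "f permutes S" "finite S" "a \<in> S" "b \<in> S" "a \<noteq> b"
  shows "int (num_cycles S (f \<circ> transpose a b)) =
    int (num_cycles S f) + (if b \<in> orbit f a then 1 else - 1)"
proof -
  let ?g = "f \<circ> transpose a b"
  have g: "?g permutes S"
    using assms by (intro permutes_compose permutes_swap_id)
  have 1: "num_comps S (fun_graph f) =
      num_comps S (insert (a, b) (fun_graph f)) + (if b \<in> orbit f a then 0 else 1)"
    using num_comps_insert[OF assms(2-4), of "fun_graph f"] orbit_eq_conn[OF assms(1,2)] by auto
  have 2: "num_comps S (fun_graph ?g) =
      num_comps S (insert (a, b) (fun_graph ?g)) + (if b \<in> orbit ?g a then 0 else 1)"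
    using num_comps_insert[OF assms(2-4), of "fun_graph ?g"] orbit_eq_conn[OF g assms(2)] by auto
  have "conn (insert (a, b) (fun_graph ?g)) = conn (insert (a, b) (fun_graph f))"
    using conn_transpose[of a b f "{}"] by simp
  then have "num_comps S (insert (a, b) (fun_graph ?g)) = num_comps S (insert (a, b) (fun_graph f))"
    by (simp add: num_comps_def)
  with 1 2 orbit_transpose_iff[OF assms] show ?thesis
    by (auto simp: num_cycles_eq_num_comps[OF assms(1,2)] num_cycles_eq_num_comps[OF g assms(2)])
qed

section \<open>Genus under splitting of cycles\<close>

lemma num_cycles_id: "num_cycles S id = card S"
proof -
  have "orbit id x = {x}" for x :: 'a
    by (simp add: orbit_eq_singleton_iff)
  then show ?thesis by (simp add: num_cycles_def perm_cycles_def card_image)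
qed

lemma num_cycles_le: "finite S \<Longrightarrow> num_cycles S f \<le> card S"
  by (simp add: num_cycles_def perm_cycles_def card_image_le)

section \<open>Length of a permutation and the triangle inequality\<close>

lemma permutes_transpose_induct [consumes 2, case_names id transpose]:
  assumes "f permutes S" "finite S" "P id"
    and "\<And>f a. f permutes S \<Longrightarrow> a \<in> S \<Longrightarrow> f a \<in> S \<Longrightarrow> f a \<noteq> a \<Longrightarrow> f \<circ> transpose a (f a) permutes S \<Longrightarrow>
      num_cycles S (f \<circ> transpose a (f a)) = num_cycles S f + 1 \<Longrightarrow> P (f \<circ> transpose a (f a)) \<Longrightarrow> P f"
  shows "P f"
  using assms(1)
proof (induction "card S - num_cycles S f" arbitrary: f rule: less_induct)
  case less
  show ?case
  proof (cases "f = id")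
    case False
    then obtain a where a: "f a \<noteq> a" by (auto simp: fun_eq_iff)
    have aS: "a \<in> S" "f a \<in> S" using a less(2) permutes_not_in permutes_in_image by metis+
    \<comment> \<open>This permutation fixes \<open>f a\<close>, which has been cut out of its
      cycle; it is one transposition closer to the identity.\<close>
    let ?g = "f \<circ> transpose a (f a)"
    have g: "?g permutes S" using less(2) aS by (intro permutes_compose permutes_swap_id)
    have z: "num_cycles S ?g = num_cycles S f + 1"
      using num_cycles_transpose[OF less(2) assms(2) aS a[symmetric]] by (simp add: orbit.base)
    have "card S - num_cycles S ?g < card S - num_cycles S f"
      using z num_cycles_le[OF assms(2), of ?g] by linarith
    then show ?thesis using assms(4)[OF less(2) aS a g z] less(1) g by blast
  qed (simp add: assms(3))
qed

text \<open>The triangle inequality for the length \<open>card S - num_cycles S f\<close>: each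
  transposition taken off \<open>g\<close> changes the count of the product by at most one.\<close>

lemma num_cycles_comp_le:
  assumes "g permutes S" "finite S" "f permutes S"
  shows "num_cycles S f + num_cycles S g \<le> card S + num_cycles S (f \<circ> g)"
  using assms(1,2)
proof (induction g rule: permutes_transpose_induct)
  case id
  then show ?case using num_cycles_id[of S] num_cycles_le[OF assms(2), of f] by (simp add: id_def comp_def)
next
  case (transpose g a)
  have "f \<circ> g permutes S" using transpose(1) assms(3) by (intro permutes_compose)
  from num_cycles_transpose[OF this assms(2) transpose(2,3)] transpose(4)
  have "int (num_cycles S (f \<circ> g \<circ> transpose a (g a))) \<le> int (num_cycles S (f \<circ> g)) + 1" by simp
  with transpose(6,7) show ?case by (simp add: comp_def)
qed

text \<open>For a hypermap, this is twice the genus. A product of the form \<open>\<sigma>\<inverse>\<alpha>\<close> rather than its inverse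
  \<open>\<alpha>\<inverse>\<sigma>\<close> is counted, so that a transposition acts on the right of both \<open>\<alpha>\<close> and the product.\<close>

definition defect :: "'a set \<Rightarrow> ('a \<Rightarrow> 'a) \<Rightarrow> ('a \<Rightarrow> 'a) \<Rightarrow> int" where
  "defect S \<sigma> \<alpha> = int (card S) + 2 * int (num_comps S (fun_graph \<alpha> \<union> fun_graph \<sigma>))
     - int (num_cycles S \<sigma>) - int (num_cycles S \<alpha>) - int (num_cycles S (inv' \<sigma> \<circ> \<alpha>))"

text \<open>Points sharing a cycle of the product share a component. This excludes a lost connection
  in the case where the product merges two cycles.\<close>

lemma conn_fun_graph_inv_comp:
  assumes "bij \<sigma>"
  shows "conn (fun_graph (inv' \<sigma> \<circ> \<alpha>)) \<subseteq> conn (fun_graph \<alpha> \<union> fun_graph \<sigma>)"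
proof (rule conn_subsetI, rule subrelI)
  fix x y assume "(x, y) \<in> fun_graph (inv' \<sigma> \<circ> \<alpha>)"
  then have "\<sigma> y = \<alpha> x" using assms by (auto simp: fun_graph_def bij_is_surj surj_f_inv_f)
  moreover have "(y, \<sigma> y) \<in> conn (fun_graph \<alpha> \<union> fun_graph \<sigma>)"
    "(x, \<alpha> x) \<in> conn (fun_graph \<alpha> \<union> fun_graph \<sigma>)"
    by (rule conn_incl, auto simp: fun_graph_def)+
  ultimately show "(x, y) \<in> conn (fun_graph \<alpha> \<union> fun_graph \<sigma>)"
    by (metis conn_sym conn_trans)
qed

text \<open>The count for \<alpha> always rises by one. If the product splits too, the total gain of
  2 covers the at most one new component, which is counted twice. If the product merges, the two
  counts cancel, and \<open>a\<close> and \<open>b\<close> stay connected through the merged cycle,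
  so no component is added.\<close>

lemma defect_transpose_le:
  assumes "finite S" "\<sigma> permutes S" "\<alpha> permutes S" "a \<in> S" "b \<in> S" "a \<noteq> b" "b \<in> orbit \<alpha> a"
  shows "defect S \<sigma> (\<alpha> \<circ> transpose a b) \<le> defect S \<sigma> \<alpha>"
proof -
  let ?\<beta> = "\<alpha> \<circ> transpose a b" and ?\<rho> = "inv' \<sigma> \<circ> \<alpha>"
  let ?R = "fun_graph \<alpha> \<union> fun_graph \<sigma>" and ?R' = "fun_graph ?\<beta> \<union> fun_graph \<sigma>"
  have \<rho>: "?\<rho> permutes S" using assms by (intro permutes_compose permutes_inv)
  have \<beta>: "?\<beta> permutes S" using assms by (intro permutes_compose permutes_swap_id)
  have \<rho>': "?\<rho> \<circ> transpose a b permutes S" by (intro permutes_compose[OF permutes_swap_id] \<rho> assms)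
  have z: "int (num_cycles S ?\<beta>) = int (num_cycles S \<alpha>) + 1"
    using num_cycles_transpose[OF assms(3,1,4-6)] assms(7) by simp
  have "(a, b) \<in> conn (fun_graph \<alpha>)"
    using assms(7) orbit_eq_conn[OF assms(3,1)] by auto
  then have "(a, b) \<in> conn ?R" using conn_mono[of "fun_graph \<alpha>" ?R] by auto
  then have k: "num_comps S ?R = num_comps S (insert (a, b) ?R)"
    using num_comps_insert[OF assms(1,4,5), of ?R] by simp
  have "num_comps S (insert (a, b) ?R') = num_comps S (insert (a, b) ?R)"
    by (simp add: num_comps_def conn_transpose)
  then have k': "num_comps S ?R' = num_comps S ?R + (if (a, b) \<in> conn ?R' then 0 else 1)"
    using num_comps_insert[OF assms(1,4,5), of ?R'] k by simp
  note z' = num_cycles_transpose[OF \<rho> assms(1,4-6)]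
  show ?thesis
  proof (cases "b \<in> orbit ?\<rho> a")
    case True
    then show ?thesis using z z' k' by (simp add: defect_def comp_assoc)
  next
    case False
    then have "b \<in> orbit (?\<rho> \<circ> transpose a b) a"
      using orbit_transpose_iff[OF \<rho> assms(1,4-6)] by simp
    then have "(a, b) \<in> conn (fun_graph (inv' \<sigma> \<circ> ?\<beta>))"
      using orbit_eq_conn[OF \<rho>' assms(1)] by (simp add: comp_assoc)
    then have "(a, b) \<in> conn ?R'"
      using conn_fun_graph_inv_comp[OF permutes_bij[OF assms(2)]] by blast
    then show ?thesis using False z z' k' by (simp add: defect_def comp_assoc)
  qed
qed

text \<open>Equality in \<open>num_cycles_comp_le\<close> forces each transposition removed from \<open>\<gamma>\<close> to split a
  cycle of the product.\<close>

lemma defect_geodesic_le: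
  assumes "\<gamma> permutes S" "finite S" "\<sigma> permutes S" "\<beta> permutes S"
    and "num_cycles S \<beta> + num_cycles S \<gamma> = card S + num_cycles S (\<beta> \<circ> \<gamma>)"
  shows "defect S \<sigma> \<beta> \<le> defect S \<sigma> (\<beta> \<circ> \<gamma>)"
  using assms(1,2,5)
proof (induction \<gamma> rule: permutes_transpose_induct)
  case id
  then show ?case by simp
next
  case (transpose g a)
  let ?t = "transpose a (g a)"
  have p: "\<beta> \<circ> g permutes S" using transpose(1) assms(4) by (intro permutes_compose)
  note z = num_cycles_transpose[OF p assms(2) transpose(2,3) transpose(4)[symmetric]]
  have le: "num_cycles S \<beta> + num_cycles S (g \<circ> ?t) \<le> card S + num_cycles S (\<beta> \<circ> (g \<circ> ?t))"
    by (rule num_cycles_comp_le[OF transpose(5) assms(2,4)])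
  \<comment> \<open>Removing the transposition raises the count of \<open>g\<close> by one, so
    \<open>le\<close> forces the count of the product up as well; a merge would violate it.\<close>
  have o: "g a \<in> orbit (\<beta> \<circ> g) a"
    using z le transpose(6,8) by (auto simp: comp_def split: if_splits)
  have "defect S \<sigma> \<beta> \<le> defect S \<sigma> (\<beta> \<circ> (g \<circ> ?t))"
    using z le transpose(6,8) o by (intro transpose(7)) (simp add: comp_def)
  also have "\<dots> \<le> defect S \<sigma> (\<beta> \<circ> g)"
    using defect_transpose_le[OF assms(2,3) p transpose(2,3) transpose(4)[symmetric] o]
    by (simp add: comp_assoc)
  finally show ?case .
qed

lemma num_cycles_inv: "f permutes S \<Longrightarrow> finite S \<Longrightarrow> num_cycles S (inv' f) = num_cycles S f"
  by (metis (no_types, lifting) num_cycles_def perm_cycles_def image_cong orbit_inv_eq permutation_permutes)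

lemma defect_id:
  assumes "finite S" "\<sigma> permutes S"
  shows "defect S \<sigma> id = 0"
proof -
  have "fun_graph id \<union> fun_graph \<sigma> \<subseteq> conn (fun_graph \<sigma>)"
    by (auto simp: fun_graph_def intro: conn_incl)
  then have "conn (fun_graph id \<union> fun_graph \<sigma>) = conn (fun_graph \<sigma>)"
    using conn_subsetI conn_mono[of "fun_graph \<sigma>" "fun_graph id \<union> fun_graph \<sigma>"] by blast
  then have "num_comps S (fun_graph id \<union> fun_graph \<sigma>) = num_cycles S \<sigma>"
    by (simp add: num_cycles_eq_num_comps[OF assms(2,1)] num_comps_def)
  then show ?thesis
    using assms by (simp add: defect_def num_cycles_id num_cycles_inv)
qed

text \<open>The identity lies on a geodesic to every permutation, so the genus inequality is the
  case \<beta> = \<open>id\<close> of monotonicity.\<close>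

lemma defect_nonneg:
  assumes "finite S" "\<sigma> permutes S" "\<alpha> permutes S"
  shows "defect S \<sigma> \<alpha> \<ge> 0"
  using defect_geodesic_le[OF assms(3,1,2) permutes_id] defect_id[OF assms(1,2)]
  by (simp add: num_cycles_id)

text \<open>The cycle equation places \<beta> on a geodesic from the identity to \<alpha>; its
  defect is squeezed between 0 and that of \<alpha>.\<close>

lemma defect_geodesic_eq_0:
  assumes "finite S" "\<sigma> permutes S" "\<alpha> permutes S" "\<beta> permutes S" "defect S \<sigma> \<alpha> = 0"
    and "num_cycles S \<beta> + num_cycles S (inv' \<beta> \<circ> \<alpha>) = card S + num_cycles S \<alpha>"
  shows "defect S \<sigma> \<beta> = 0"
proof -
  have eq: "\<beta> \<circ> (inv' \<beta> \<circ> \<alpha>) = \<alpha>"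
    using permutes_inv_o(1)[OF assms(4)] by (simp flip: comp_assoc)
  have "defect S \<sigma> \<beta> \<le> defect S \<sigma> \<alpha>"
    using defect_geodesic_le[of "inv' \<beta> \<circ> \<alpha>" S \<sigma> \<beta>] assms eq
    by (simp add: permutes_compose permutes_inv)
  with defect_nonneg[OF assms(1,2,4)] assms(5) show ?thesis by simp
qed

section \<open>Orbits of the generated group as connected components\<close>

lemma generate_orbit_eq_conn:
  assumes "\<sigma> permutes {1..n}" "\<alpha> permutes {1..n}"
  shows "(\<lambda>g. g x) ` generate (sym_group n) {\<sigma>, \<alpha>} = conn (fun_graph \<alpha> \<union> fun_graph \<sigma>) `` {x}"
proof -
  let ?G = "sym_group n" and ?R = "fun_graph \<alpha> \<union> fun_graph \<sigma>"
  have inv_eq: "inv\<^bsub>?G\<^esub> h = inv' h" if "h \<in> {\<sigma>, \<alpha>}" for h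
    using that assms by (auto intro!: sym_group_inv_equality simp: sym_group_carrier)
  have g: "(x, g x) \<in> conn ?R" if "g \<in> generate ?G {\<sigma>, \<alpha>}" for g x
    using that
  proof (induction arbitrary: x)
    case one
    show ?case by (simp add: sym_group_def)
  next
    case (incl h)
    then show ?case by (intro conn_incl) (auto simp: fun_graph_def)
  next
    case (inv h)
    then have "(inv' h x, h (inv' h x)) \<in> conn ?R" by (intro conn_incl) (auto simp: fun_graph_def)
    moreover have "h (inv' h x) = x" using inv assms by (auto simp: permutes_inverses)
    ultimately show ?case using inv_eq[OF inv] by (simp add: conn_sym)
  next
    case (eng g h)
    have "(x, h x) \<in> conn ?R" "(h x, g (h x)) \<in> conn ?R" by (rule eng)+
    then show ?case by (auto simp: sym_group_def intro: conn_trans)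
  qed
  have "y \<in> (\<lambda>g. g x) ` generate ?G {\<sigma>, \<alpha>}" if "(x, y) \<in> conn ?R" for y
    using that
  proof (induction rule: conn_induct)
    case refl
    show ?case by (rule image_eqI[OF _ generate.one]) (simp add: sym_group_def)
  next
    case (step y z)
    then obtain g h where gh: "g \<in> generate ?G {\<sigma>, \<alpha>}" "y = g x" "h \<in> {\<sigma>, \<alpha>}" "z = h y"
      by (auto simp: fun_graph_def)
    then have "h \<otimes>\<^bsub>?G\<^esub> g \<in> generate ?G {\<sigma>, \<alpha>}" by (blast intro: generate.eng generate.incl)
    then show ?case using gh
      by (intro image_eqI[of _ _ "h \<otimes>\<^bsub>?G\<^esub> g"]) (auto simp: sym_group_def)
  next
    \<comment> \<open>A backward edge is followed by the group inverse of a generator.\<close>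
    case (converse_step y z)
    then obtain g h where gh: "g \<in> generate ?G {\<sigma>, \<alpha>}" "y = g x" "h \<in> {\<sigma>, \<alpha>}" "y = h z"
      by (auto simp: fun_graph_def)
    then have "inv\<^bsub>?G\<^esub> h \<otimes>\<^bsub>?G\<^esub> g \<in> generate ?G {\<sigma>, \<alpha>}" by (blast intro: generate.eng generate.inv)
    moreover have "z = inv' h y" using gh(3,4) assms by (metis insertE permutes_inverses(2) singletonD)
    ultimately show ?case using gh inv_eq[OF gh(3)]
      by (intro image_eqI[of _ _ "inv\<^bsub>?G\<^esub> h \<otimes>\<^bsub>?G\<^esub> g"]) (auto simp: sym_group_def)
  qed
  with g show ?thesis by auto
qed

lemma kappa_eq_num_comps:
  assumes "\<sigma> permutes {1..n}" "\<alpha> permutes {1..n}"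
  shows "kappa n \<sigma> \<alpha> = num_comps {1..n} (fun_graph \<alpha> \<union> fun_graph \<sigma>)"
  by (simp add: kappa_def num_comps_def generate_orbit_eq_conn[OF assms])

text \<open>Bridges the product counted by the genus and its inverse, counted by
  \<open>defect\<close>.\<close>

lemma num_cycles_inv_comp_swap:
  assumes "\<sigma> permutes S" "\<alpha> permutes S" "finite S"
  shows "num_cycles S (inv' \<alpha> \<circ> \<sigma>) = num_cycles S (inv' \<sigma> \<circ> \<alpha>)"
proof -
  have "inv' (inv' \<sigma> \<circ> \<alpha>) = inv' \<alpha> \<circ> \<sigma>"
    using assms by (simp add: o_inv_distrib permutes_bij bij_imp_bij_inv inv_inv_eq)
  moreover have "inv' \<sigma> \<circ> \<alpha> permutes S" using assms by (intro permutes_compose permutes_inv)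
  ultimately show ?thesis using num_cycles_inv[of "inv' \<sigma> \<circ> \<alpha>"] assms(3) by simp
qed

section \<open>Noncrossing matchings of a single cycle\<close>

lemma bij_betw_funpow_cyclic_on:
  assumes "cyclic_on s V" "a \<in> V"
  shows "bij_betw (\<lambda>i. (s ^^ i) a) {..<card V} V"
proof -
  have V: "orbit s a = V" using assms by (rule orbit_cyclic_eq3)
  then have "a \<in> orbit s a" using assms(2) by simp
  note * = inj_on_funpow_dist1[OF this] orbit_conv_funpow_dist1[OF this]
  from * have "card V = funpow_dist1 s a a" using V by (simp add: card_image)
  with * V show ?thesis by (simp add: bij_betw_def atLeast0LessThan)
qed

lemma funpow_cyclic_on_eq_iff:
  assumes "cyclic_on s V" "a \<in> V" "i < card V" "j < card V"
  shows "(s ^^ i) a = (s ^^ j) a \<longleftrightarrow> i = j"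
  using bij_betw_funpow_cyclic_on[OF assms(1,2)] assms(3,4) by (auto simp: bij_betw_def inj_on_def)

lemma involution_induct [consumes 3, case_names id remove]:
  assumes "finite V" "\<mu> permutes V" "\<And>x. \<mu> (\<mu> x) = x"
    and "P id"
    and "\<And>\<mu> \<mu>' a. \<mu> permutes V \<Longrightarrow> \<mu>' permutes V \<Longrightarrow> (\<And>x. \<mu> (\<mu> x) = x) \<Longrightarrow>
      a \<in> V \<Longrightarrow> \<mu> a \<in> V \<Longrightarrow> \<mu> a \<noteq> a \<Longrightarrow> \<mu> = \<mu>' \<circ> transpose a (\<mu> a) \<Longrightarrow>
      (\<And>x. \<mu>' x = (if x = a \<or> x = \<mu> a then x else \<mu> x)) \<Longrightarrow>
      card {x \<in> V. \<mu> x \<noteq> x} = card {x \<in> V. \<mu>' x \<noteq> x} + 2 \<Longrightarrow> P \<mu>' \<Longrightarrow> P \<mu>"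
  shows "P \<mu>"
  using assms(2,3)
proof (induction "card {x \<in> V. \<mu> x \<noteq> x}" arbitrary: \<mu> rule: less_induct)
  case less
  show ?case
  proof (cases "\<mu> = id")
    case False
    then obtain a where a: "\<mu> a \<noteq> a" by (auto simp: fun_eq_iff)
    have aV: "a \<in> V" "\<mu> a \<in> V" using a less(2) permutes_not_in permutes_in_image by metis+
    define \<mu>' where "\<mu>' = \<mu> \<circ> transpose a (\<mu> a)"
    have \<mu>': "\<mu>' x = (if x = a \<or> x = \<mu> a then x else \<mu> x)" for x
      using less(3)[of a] by (auto simp: \<mu>'_def transpose_def)
    have perm: "\<mu>' permutes V"
      unfolding \<mu>'_def by (intro permutes_compose[OF permutes_swap_id] less(2) aV)
    have comp: "\<mu> = \<mu>' \<circ> transpose a (\<mu> a)" by (simp add: \<mu>'_def comp_assoc)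
    have inj: "\<mu> x = \<mu> y \<longleftrightarrow> x = y" for x y using less(3) by metis
    have invol: "\<mu>' (\<mu>' x) = x" for x
      using inj[of x a] inj[of x "\<mu> a"] less(3) by (auto simp: \<mu>')
    have "{x \<in> V. \<mu> x \<noteq> x} = insert a (insert (\<mu> a) {x \<in> V. \<mu>' x \<noteq> x})"
      using a aV less(3)[of a] by (auto simp: \<mu>')
    then have card: "card {x \<in> V. \<mu> x \<noteq> x} = card {x \<in> V. \<mu>' x \<noteq> x} + 2"
      using assms(1) a by (simp add: \<mu>' card_insert_if)
    then have "P \<mu>'" using less(1)[of \<mu>'] perm invol by simp
    from assms(5)[OF less(2) perm less(3) aV a comp \<mu>' card this] show ?thesis .
  qed (simp add: assms(4))
qed

lemma num_cycles_comp_involution_le: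
  assumes "finite V" "\<mu> permutes V" "\<And>x. \<mu> (\<mu> x) = x" "f permutes V"
  shows "2 * num_cycles V (f \<circ> \<mu>) \<le> 2 * num_cycles V f + card {x \<in> V. \<mu> x \<noteq> x}"
  using assms(1-3)
proof (induction \<mu> rule: involution_induct)
  case id
  show ?case by simp
next
  case (remove \<mu> \<mu>' a)
  have p: "f \<circ> \<mu>' permutes V" by (rule permutes_compose[OF remove(2) assms(4)])
  have "f \<circ> \<mu> = f \<circ> \<mu>' \<circ> transpose a (\<mu> a)" using remove(7) by (metis comp_assoc)
  moreover have "int (num_cycles V (f \<circ> \<mu>' \<circ> transpose a (\<mu> a))) \<le> int (num_cycles V (f \<circ> \<mu>')) + 1"
    using num_cycles_transpose[OF p assms(1) remove(4,5)] remove(6) by simp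
  ultimately have "num_cycles V (f \<circ> \<mu>) \<le> num_cycles V (f \<circ> \<mu>') + 1" by simp
  with remove(9,10) show ?case by linarith
qed

text \<open>Fixed points of \<mu> stand for unmatched points. When \<open>s\<close> is cyclic on
  \<open>V\<close>, the bounds on \<open>i\<close>, \<open>j\<close>, \<open>k\<close> keep them out
  of every crossing.\<close>

definition crossing_free :: "('a \<Rightarrow> 'a) \<Rightarrow> 'a set \<Rightarrow> ('a \<Rightarrow> 'a) \<Rightarrow> bool" where
  "crossing_free s V \<mu> \<longleftrightarrow>
     \<not> (\<exists>a\<in>V. \<exists>i j k. 0 < i \<and> i < j \<and> j < k \<and> k < card V \<and>
          \<mu> a = (s ^^ j) a \<and> \<mu> ((s ^^ i) a) = (s ^^ k) a)"

lemma num_cycles_cyclic_on: "cyclic_on s V \<Longrightarrow> num_cycles V s = 1"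
  by (auto simp: num_cycles_def perm_cycles_def cyclic_on_alldef card_1_singleton_iff)

text \<open>A pair that no other pair crosses has both ends in one cycle of the product formed so
  far. Hence every pair splits off one more cycle, starting from the single cycle of
  \<open>s\<close>.\<close>

lemma num_cycles_crossing_free:
  assumes "finite V" "\<mu> permutes V" "\<And>x. \<mu> (\<mu> x) = x"
    and s: "s permutes V" "cyclic_on s V" and "crossing_free s V \<mu>"
  shows "2 * num_cycles V (s \<circ> \<mu>) = 2 + card {x \<in> V. \<mu> x \<noteq> x}"
  using assms(1-3,6)
proof (induction \<mu> rule: involution_induct)
  case id
  show ?case by (simp add: num_cycles_cyclic_on[OF s(2)])
next
  case (remove \<mu> \<mu>' a)
  have pow: "(s ^^ i) x = (s ^^ j) x \<longleftrightarrow> i = j" if "x \<in> V" "i < card V" "j < card V" for x i j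
    using funpow_cyclic_on_eq_iff[OF s(2)] that .
  have pow0: "(s ^^ i) x \<noteq> x" if "x \<in> V" "0 < i" "i < card V" for x i
    using pow[of x i 0] that by simp
  have ex_pow: "\<exists>i<card V. y = (s ^^ i) a" if "y \<in> V" for y
    using bij_betw_funpow_cyclic_on[OF s(2) remove(4)] that by (auto simp: bij_betw_def)
  have free': "crossing_free s V \<mu>'"
    unfolding crossing_free_def
  proof safe
    fix b i j k
    assume b: "b \<in> V" and ijk: "0 < i" "i < j" "j < k" "k < card V"
      and m: "\<mu>' b = (s ^^ j) b" "\<mu>' ((s ^^ i) b) = (s ^^ k) b"
    have "(s ^^ j) b \<noteq> b" "(s ^^ k) b \<noteq> (s ^^ i) b"
      using pow0[OF b] pow[OF b] ijk by auto
    then have "\<mu> b = (s ^^ j) b" "\<mu> ((s ^^ i) b) = (s ^^ k) b"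
      using m by (auto simp: remove(8) split: if_splits)
    then show False using remove(11) b ijk unfolding crossing_free_def by blast
  qed
  let ?g = "s \<circ> \<mu>'"
  have p: "?g permutes V" by (rule permutes_compose[OF remove(2) s(1)])
  obtain j where j: "j < card V" "\<mu> a = (s ^^ j) a" using ex_pow[OF remove(5)] by blast
  have j0: "0 < j" using j remove(6) by (cases j) auto
  define A where "A = (\<lambda>l. (s ^^ l) a) ` {1..j}"
  \<comment> \<open>No pair crosses \<open>{a, \<mu> a}\<close>, so the orbit of \<open>a\<close> can leave the arc \<open>A\<close> only through \<open>\<mu> a\<close>.\<close>
  have "\<mu> a \<in> orbit ?g a"
  proof (rule orbit_escape[where A = A])
    show "a \<in> orbit ?g a"
      using p assms(1) by (meson permutation_permutes permutation_self_in_orbit)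
    show "a \<notin> A"
    proof
      assume "a \<in> A"
      then obtain l where "l \<in> {1..j}" "(s ^^ l) a = a" by (auto simp: A_def)
      then show False using pow0[OF remove(4), of l] j(1) by simp
    qed
    show "?g a \<in> A" using j0 by (auto simp: A_def remove(8) intro!: image_eqI[of _ _ 1])
  next
    fix y assume y: "y \<in> A" "y \<noteq> \<mu> a"
    then obtain l where l': "l \<in> {1..j}" "y = (s ^^ l) a" by (auto simp: A_def)
    then have "l \<noteq> j" using j(2) y(2) by metis
    then have l: "0 < l" "l < j" "y = (s ^^ l) a" using l' by simp_all
    have "y \<in> V" unfolding l(3) using s(2) remove(4) by (rule cyclic_on_funpow_in)
    then obtain k where k: "k < card V" "\<mu> y = (s ^^ k) a"
      using ex_pow permutes_in_image[OF remove(1)] by blast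
    have ya: "y \<noteq> a" using pow0[OF remove(4), of l] l j(1) by simp
    \<comment> \<open>Position 0 would give \<open>\<mu> y = a\<close>, position \<open>j\<close>
      would give \<open>\<mu> y = \<mu> a\<close>, and a position beyond \<open>j\<close> would
      cross the pair \<open>{a, \<mu> a}\<close>. From a position below \<open>j\<close>, one more
      step of \<open>s\<close> stays in the arc.\<close>
    have "k \<noteq> 0" using k(2) remove(3)[of y] y(2) by (metis funpow_0)
    moreover have "k \<noteq> j" using k(2) j(2) ya remove(3) by metis
    moreover have "\<not> j < k"
      using remove(11,4) l j k unfolding crossing_free_def by blast
    ultimately have "Suc k \<in> {1..j}" by simp
    moreover have "?g y = (s ^^ Suc k) a" using k(2) ya y(2) by (simp add: remove(8))
    ultimately show "?g y \<in> A" unfolding A_def by blast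
  qed
  then have "int (num_cycles V (?g \<circ> transpose a (\<mu> a))) = int (num_cycles V ?g) + 1"
    using num_cycles_transpose[OF p assms(1) remove(4,5) remove(6)[symmetric]] by simp
  moreover have "s \<circ> \<mu> = ?g \<circ> transpose a (\<mu> a)" using remove(7) by (metis comp_assoc)
  ultimately have "num_cycles V (s \<circ> \<mu>) = num_cycles V ?g + 1" by simp
  with remove(9) remove(10)[OF free'] show ?case by (simp add: comp_def)
qed

text \<open>Two crossing pairs together bring no net gain, and every other pair gains at most one
  cycle, so the count stays at least two below its maximum.\<close>

lemma num_cycles_crossing_less:
  assumes "finite V" "\<mu> permutes V" "\<And>x. \<mu> (\<mu> x) = x"
    and s: "s permutes V" "cyclic_on s V" and "\<not> crossing_free s V \<mu>"
  shows "2 * num_cycles V (s \<circ> \<mu>) < 2 + card {x \<in> V. \<mu> x \<noteq> x}"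
proof -
  obtain a i j k where a: "a \<in> V" and ijk: "0 < i" "i < j" "j < k" "k < card V"
    and m: "\<mu> a = (s ^^ j) a" "\<mu> ((s ^^ i) a) = (s ^^ k) a"
    using assms(6) unfolding crossing_free_def by blast
  have pow: "(s ^^ l) a = (s ^^ l') a \<longleftrightarrow> l = l'" if "l < card V" "l' < card V" for l l'
    using funpow_cyclic_on_eq_iff[OF s(2) a] that .
  define b c d where "b = (s ^^ i) a" and "c = (s ^^ j) a" and "d = (s ^^ k) a"
  have V: "b \<in> V" "c \<in> V" "d \<in> V"
    unfolding b_def c_def d_def using s(2) a by (auto intro: cyclic_on_funpow_in)
  have ne: "a \<noteq> b" "a \<noteq> c" "a \<noteq> d" "b \<noteq> c" "b \<noteq> d" "c \<noteq> d"
    unfolding b_def c_def d_def using ijk pow pow[of 0] by auto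
  have mu: "\<mu> a = c" "\<mu> b = d" "\<mu> c = a" "\<mu> d = b"
    using m assms(3) by (metis b_def c_def d_def)+
  let ?t = "transpose a c" and ?u = "transpose b d"
  define \<mu>' where "\<mu>' = \<mu> \<circ> ?t \<circ> ?u"
  have \<mu>': "\<mu>' x = (if x \<in> {a, b, c, d} then x else \<mu> x)" for x
    using ne mu by (auto simp: \<mu>'_def transpose_def)
  have perm': "\<mu>' permutes V"
    unfolding \<mu>'_def by (intro permutes_compose[OF permutes_swap_id] assms(2) V a)
  have inj: "\<mu> x = \<mu> y \<longleftrightarrow> x = y" for x y using assms(3) by metis
  have notin: "\<mu> x \<notin> {a, b, c, d}" if "x \<notin> {a, b, c, d}" for x
    using that mu inj[of x a] inj[of x b] inj[of x c] inj[of x d] by auto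
  have invol': "\<mu>' (\<mu>' x) = x" for x
    using notin[of x] by (simp add: \<mu>' assms(3))
  \<comment> \<open>Since \<open>\<mu>'\<close> moves none of the four points, the two
    transpositions may be put to its left, so that they are applied to \<open>s\<close> before all
    other pairs.\<close>
  have "\<mu> x = (?t \<circ> ?u \<circ> \<mu>') x" for x
  proof (cases "x \<in> {a, b, c, d}")
    case True
    then show ?thesis using ne mu by (auto simp: \<mu>' transpose_def)
  next
    case False
    then show ?thesis using notin[OF False] by (simp add: \<mu>' transpose_def)
  qed
  then have decomp: "s \<circ> \<mu> = s \<circ> ?t \<circ> ?u \<circ> \<mu>'" by (auto simp: fun_eq_iff)
  have "{x \<in> V. \<mu> x \<noteq> x} = {a, b, c, d} \<union> {x \<in> V. \<mu>' x \<noteq> x}"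
    using V a ne mu by (auto simp: \<mu>')
  moreover have "{a, b, c, d} \<inter> {x \<in> V. \<mu>' x \<noteq> x} = {}" by (auto simp: \<mu>')
  ultimately have card: "card {x \<in> V. \<mu> x \<noteq> x} = 4 + card {x \<in> V. \<mu>' x \<noteq> x}"
    using assms(1) ne by (simp add: card_Un_disjoint)
  have p1: "s \<circ> ?t permutes V" by (intro permutes_compose[OF permutes_swap_id] s V a)
  have p2: "s \<circ> ?t \<circ> ?u permutes V" by (intro permutes_compose[OF permutes_swap_id] p1 V)
  have "c \<in> orbit s a" using orbit_cyclic_eq3[OF s(2) a] V by simp
  then have z1: "int (num_cycles V (s \<circ> ?t)) = 2"
    using num_cycles_transpose[OF s(1) assms(1) a V(2) ne(2)] num_cycles_cyclic_on[OF s(2)] by simp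
  \<comment> \<open>Of the two crossing pairs, the first splits the cycle and the second merges it again.\<close>
  have "d \<notin> orbit (s \<circ> ?t) b"
  proof
    assume "d \<in> orbit (s \<circ> ?t) b"
    \<comment> \<open>The points at positions 1 to \<open>j\<close> form a closed arc under
      \<open>s \<circ> ?t\<close>. It contains \<open>b\<close> at position \<open>i\<close> and
      ends before \<open>d\<close> at position \<open>k\<close>.\<close>
    then have "\<exists>l. 0 < l \<and> l \<le> j \<and> d = (s ^^ l) a"
      unfolding b_def c_def
    proof (rule funpow_transpose_invariant[rotated -1])
      show "(s ^^ l) a \<noteq> a" if "0 < l" "l \<le> j" for l using pow[of l 0] that ijk by simp
      show "inj_on (\<lambda>i. (s ^^ i) a) {1..j}" using pow ijk by (intro inj_onI) auto
    qed (use ijk in auto)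
    then obtain l where "l \<le> j" "d = (s ^^ l) a" by blast
    then show False using pow[of k l] ijk by (simp add: d_def)
  qed
  then have "num_cycles V (s \<circ> ?t \<circ> ?u) = 1"
    using num_cycles_transpose[OF p1 assms(1) V(1,3) ne(5)] z1 by simp
  with num_cycles_comp_involution_le[OF assms(1) perm' invol' p2] show ?thesis
    unfolding decomp card by simp
qed

theorem crossing_free_iff_num_cycles:
  assumes "finite V" "\<mu> permutes V" "\<And>x. \<mu> (\<mu> x) = x" "\<And>x. x \<in> V \<Longrightarrow> \<mu> x \<noteq> x"
    and "s permutes V" "cyclic_on s V"
  shows "crossing_free s V \<mu> \<longleftrightarrow> 2 * num_cycles V (s \<circ> \<mu>) = card V + 2"
proof -
  have "{x \<in> V. \<mu> x \<noteq> x} = V" using assms(4) by auto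
  then show ?thesis
    using num_cycles_crossing_free[OF assms(1-3,5,6)] num_cycles_crossing_less[OF assms(1-3,5,6)]
    by (cases "crossing_free s V \<mu>") auto
qed

section \<open>Restriction to blocks and counting\<close>

lemma perm_restrict_permutes:
  assumes "finite V" "inj_on f V" "f ` V \<subseteq> V"
  shows "perm_restrict f V permutes V"
proof (rule bij_imp_permutes)
  have "bij_betw f V V" using assms by (simp add: bij_betw_def endo_inj_surj)
  then show "bij_betw (perm_restrict f V) V V"
    by (rule bij_betw_cong[THEN iffD1, rotated]) (simp add: perm_restrict_simps)
qed (simp add: perm_restrict_simps)

lemma num_cycles_cong:
  assumes "\<And>x. x \<in> A \<Longrightarrow> f x = g x" "f ` A \<subseteq> A"
  shows "num_cycles A f = num_cycles A g"
proof -
  have "orbit f x = orbit g x" if "x \<in> A" for x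
    using orbit_cong0[of x A f g] that assms by auto
  then show ?thesis by (simp add: num_cycles_def perm_cycles_def)
qed

lemma orbit_subset_invariant:
  assumes "x \<in> A" "f ` A \<subseteq> A"
  shows "orbit f x \<subseteq> A"
proof
  fix y assume "y \<in> orbit f x"
  then show "y \<in> A" by induction (use assms in auto)
qed

lemma num_cycles_Un_disjoint:
  assumes "finite A" "finite B" "A \<inter> B = {}" "f ` A \<subseteq> A" "f ` B \<subseteq> B"
  shows "num_cycles (A \<union> B) f = num_cycles A f + num_cycles B f"
proof -
  have "orbit f ` A \<inter> orbit f ` B = {}"
  proof (rule ccontr)
    assume "orbit f ` A \<inter> orbit f ` B \<noteq> {}"
    then obtain x y where xy: "x \<in> A" "y \<in> B" "orbit f x = orbit f y" by auto
    then have "orbit f x \<subseteq> A \<inter> B"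
      using orbit_subset_invariant[OF xy(1) assms(4)] orbit_subset_invariant[OF xy(2) assms(5)] by simp
    then show False using assms(3) orbit_nonempty[of f x] by blast
  qed
  then show ?thesis
    using assms(1,2) by (simp add: num_cycles_def perm_cycles_def image_Un card_Un_disjoint)
qed

lemma num_cycles_Union_disjoint:
  assumes "finite Cs" "\<And>C. C \<in> Cs \<Longrightarrow> finite C" "disjoint Cs" "\<And>C. C \<in> Cs \<Longrightarrow> f ` C \<subseteq> C"
  shows "num_cycles (\<Union>Cs) f = (\<Sum>C\<in>Cs. num_cycles C f)"
  using assms
proof (induction Cs)
  case empty
  then show ?case by (simp add: num_cycles_def perm_cycles_def)
next
  case (insert C Cs)
  have "C \<inter> D = {}" if "D \<in> Cs" for D
    using insert.hyps(2) insert.prems(2) that unfolding disjoint_def by (metis insertI1 insertI2)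
  then have "C \<inter> \<Union>Cs = {}" by blast
  then have "num_cycles (C \<union> \<Union>Cs) f = num_cycles C f + num_cycles (\<Union>Cs) f"
  proof (rule num_cycles_Un_disjoint[rotated 2])
    show "finite C" "f ` C \<subseteq> C" using insert.prems by blast+
    show "finite (\<Union>Cs)" using insert.hyps(1) insert.prems(1) by blast
    show "f ` \<Union>Cs \<subseteq> \<Union>Cs" using insert.prems(3) by blast
  qed
  moreover have "num_cycles (\<Union>Cs) f = (\<Sum>C\<in>Cs. num_cycles C f)"
    using insert by (intro insert) (auto simp: disjoint_def)
  ultimately show ?case using insert by simp
qed

text \<open>Only the values of \<open>g\<close> on the image enter, so \<open>g\<close> may act on a
  larger set. This allows the positive and the negative half of a vertex to be treated with
  different maps \<open>h\<close>.\<close>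

lemma num_cycles_image:
  assumes "f permutes C" "finite C" "inj_on h C" "\<And>x. x \<in> C \<Longrightarrow> g (h x) = h (f x)"
  shows "num_cycles (h ` C) g = num_cycles C f"
proof -
  have "orbit g (h x) = h ` orbit f x" if "x \<in> C" for x
  proof -
    have "x \<in> orbit f x" using assms(1,2) by (meson permutation_permutes permutation_self_in_orbit)
    moreover have "g (h y) = h (f y)" if "y \<in> orbit f x" for y
      using that permutes_orbit_subset[OF assms(1) \<open>x \<in> C\<close>] assms(4) by blast
    ultimately show ?thesis using orbit_inverse[of x f g h] by simp
  qed
  then have eq: "orbit g ` h ` C = (`) h ` orbit f ` C" by (auto simp: image_iff)
  have "inj_on ((`) h) (orbit f ` C)"
    using permutes_orbit_subset[OF assms(1)]
    by (intro inj_on_subset[OF inj_on_image_Pow[OF assms(3)]]) auto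
  then show ?thesis by (simp add: num_cycles_def perm_cycles_def eq card_image)
qed

lemma partition_on_perm_cycles:
  assumes "f permutes S" "finite S"
  shows "partition_on S (perm_cycles S f)"
proof (rule partition_onI)
  have perm: "permutation f" using assms permutation_permutes by blast
  show "\<Union> (perm_cycles S f) = S"
    using permutes_orbit_subset[OF assms(1)] permutation_self_in_orbit[OF perm]
    by (auto simp: perm_cycles_def)
  show "disjnt p q" if "p \<in> perm_cycles S f" "q \<in> perm_cycles S f" "p \<noteq> q" for p q
    using that cyclic_on_orbit'[OF perm] unfolding disjnt_def perm_cycles_def
    by (metis (no_types, lifting) disjoint_iff imageE orbit_cyclic_eq3)
  show "{} \<notin> perm_cycles S f"
    by (metis (no_types) imageE orbit_nonempty perm_cycles_def)
qed

lemma perm_cycles_invariant: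
  assumes "f permutes S" "C \<in> perm_cycles S f"
  shows "f ` C \<subseteq> C"
  using assms by (auto simp: perm_cycles_def intro: orbit.step)

lemma perm_restrict_perm_cycle_permutes:
  assumes "f permutes S" "finite S" "C \<in> perm_cycles S f"
  shows "perm_restrict f C permutes C"
proof (rule perm_restrict_permutes)
  show "finite C" using partition_onD1[OF partition_on_perm_cycles[OF assms(1,2)]] assms(2,3)
    by (metis Union_upper finite_subset)
  show "inj_on f C" using permutes_inj[OF assms(1)] by (rule inj_on_subset) simp
qed (rule perm_cycles_invariant[OF assms(1,3)])

text \<open>Each cycle of \<alpha> contributes the 1 of the local condition, and these add up to the
  number of cycles of \<alpha>. The result is the geodesic equality on all of
  \<open>{1..n}\<close>.\<close>

lemma refines_num_cycles:
  assumes "refines n \<beta> \<alpha>" "\<alpha> permutes {1..n}"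
  shows "num_cycles {1..n} \<beta> + num_cycles {1..n} (inv' \<beta> \<circ> \<alpha>) = card {1..n} + num_cycles {1..n} \<alpha>"
proof -
  let ?S = "{1..n}"
  let ?Cs = "perm_cycles ?S \<alpha>"
  note part = partition_on_perm_cycles[OF assms(2) finite_atLeastAtMost]
  have fin: "finite ?Cs" by (simp add: perm_cycles_def)
  have finC: "finite C" if "C \<in> ?Cs" for C
    using that partition_onD1[OF part] by (metis Union_upper finite_atLeastAtMost finite_subset)
  have \<beta>: "\<beta> permutes ?S" using assms(1) by (simp add: refines_def)
  have C: "perm_restrict \<beta> C permutes C" "num_cycles C (perm_restrict \<beta> C)
      + num_cycles C (inv' (perm_restrict \<beta> C) \<circ> perm_restrict \<alpha> C) = card C + 1" if "C \<in> ?Cs" for C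
    using assms(1) that by (auto simp: refines_def)
  have maps: "\<beta> ` C \<subseteq> C" if "C \<in> ?Cs" for C
    using permutes_imp_bij[OF C(1)[OF that]] by (auto simp: bij_betw_def perm_restrict_simps)
  \<comment> \<open>Inverting and restricting commute because \<beta> maps \<open>C\<close> onto
    itself.\<close>
  have inv_eq: "(inv' \<beta> \<circ> \<alpha>) x = (inv' (perm_restrict \<beta> C) \<circ> perm_restrict \<alpha> C) x"
    if "C \<in> ?Cs" "x \<in> C" for C x
  proof -
    define y where "y = inv' (perm_restrict \<beta> C) (\<alpha> x)"
    have "\<alpha> x \<in> C" using perm_cycles_invariant[OF assms(2) that(1)] that(2) by auto
    then have "y \<in> C" unfolding y_def
      using permutes_in_image[OF permutes_inv[OF C(1)[OF that(1)]]] by blast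
    moreover have "perm_restrict \<beta> C y = \<alpha> x"
      unfolding y_def using C(1)[OF that(1)] by (rule permutes_inverses)
    ultimately have "\<beta> y = \<alpha> x" by (simp add: perm_restrict_simps)
    then have "inv' \<beta> (\<alpha> x) = y" using permutes_inverses(2)[OF \<beta>] by metis
    then show ?thesis using that by (simp add: y_def perm_restrict_simps)
  qed
  have maps': "(inv' \<beta> \<circ> \<alpha>) ` C \<subseteq> C" if "C \<in> ?Cs" for C
  proof -
    have "inv' (perm_restrict \<beta> C) \<circ> perm_restrict \<alpha> C permutes C"
      using that C(1) perm_restrict_perm_cycle_permutes[OF assms(2)]
      by (intro permutes_compose permutes_inv) auto
    from permutes_image[OF this] inv_eq[OF that] show ?thesis by force
  qed
  have "num_cycles ?S \<beta> + num_cycles ?S (inv' \<beta> \<circ> \<alpha>) =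
      (\<Sum>C\<in>?Cs. num_cycles C \<beta> + num_cycles C (inv' \<beta> \<circ> \<alpha>))"
    using num_cycles_Union_disjoint[OF fin finC partition_onD2[OF part] maps]
      num_cycles_Union_disjoint[OF fin finC partition_onD2[OF part] maps']
    unfolding partition_onD1[OF part, symmetric] by (simp only: sum.distrib)
  also have "\<dots> = (\<Sum>C\<in>?Cs. card C + 1)"
  proof (rule sum.cong)
    fix D assume D: "D \<in> ?Cs"
    have "num_cycles D \<beta> = num_cycles D (perm_restrict \<beta> D)"
      using maps[OF D] by (intro num_cycles_cong) (auto simp: perm_restrict_simps)
    moreover have "num_cycles D (inv' \<beta> \<circ> \<alpha>) = num_cycles D (inv' (perm_restrict \<beta> D) \<circ> perm_restrict \<alpha> D)"
      using maps'[OF D] inv_eq[OF D] by (intro num_cycles_cong) auto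
    ultimately show "num_cycles D \<beta> + num_cycles D (inv' \<beta> \<circ> \<alpha>) = card D + 1"
      using C(2)[OF D] by simp
  qed simp
  also have "\<dots> = (\<Sum>C\<in>?Cs. card C) + card ?Cs"
    by (simp add: sum_Suc)
  also have "(\<Sum>C\<in>?Cs. card C) = card (\<Union>?Cs)"
    using finC partition_onD2[OF part] by (simp add: card_Union_disjoint disjoint_def pairwise_def disjnt_def)
  also have "\<Union>?Cs = ?S" using partition_onD1[OF part] by simp
  finally show ?thesis by (simp add: num_cycles_def comp_def)
qed

section \<open>Counting permutations block by block and colorings cycle by cycle\<close>

lemma card_permutes_partition:
  assumes "partition_on S Cs" "finite S" "\<And>C b. C \<in> Cs \<Longrightarrow> b \<in> F C \<Longrightarrow> b permutes C"
  shows "card {\<beta>. \<beta> permutes S \<and> (\<forall>C\<in>Cs. perm_restrict \<beta> C \<in> F C)} = (\<Prod>C\<in>Cs. card (F C))"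
proof -
  note part = partition_onD1[OF assms(1)] partition_onD2[OF assms(1)]
  have fin: "finite Cs" using assms(1,2) by (meson finite_elements)
  have uniq: "C = D" if "C \<in> Cs" "D \<in> Cs" "x \<in> C" "x \<in> D" for C D x
    using that part(2) by (auto simp: disjoint_def)
  let ?A = "{\<beta>. \<beta> permutes S \<and> (\<forall>C\<in>Cs. perm_restrict \<beta> C \<in> F C)}"
  have "bij_betw (\<lambda>\<beta>. \<lambda>C\<in>Cs. perm_restrict \<beta> C) ?A (PiE Cs F)"
  proof (rule bij_betwI')
    fix \<beta> \<beta>' assume "\<beta> \<in> ?A" "\<beta>' \<in> ?A"
    then have \<beta>: "\<beta> permutes S" "\<beta>' permutes S" by auto
    show "(\<lambda>C\<in>Cs. perm_restrict \<beta> C) = (\<lambda>C\<in>Cs. perm_restrict \<beta>' C) \<longleftrightarrow> \<beta> = \<beta>'"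
    proof
      assume eq: "(\<lambda>C\<in>Cs. perm_restrict \<beta> C) = (\<lambda>C\<in>Cs. perm_restrict \<beta>' C)"
      have "\<beta> x = \<beta>' x" for x
      proof (cases "x \<in> S")
        case True
        then obtain C where "C \<in> Cs" "x \<in> C" using part(1) by blast
        then show ?thesis using fun_cong[OF eq, of C] by (metis perm_restrict_simps(1) restrict_apply')
      next
        case False
        then show ?thesis using \<beta> by (simp add: permutes_not_in)
      qed
      then show "\<beta> = \<beta>'" by blast
    qed simp
  next
    fix \<beta> assume "\<beta> \<in> ?A"
    then show "(\<lambda>C\<in>Cs. perm_restrict \<beta> C) \<in> PiE Cs F" by auto
  next
    fix w assume w: "w \<in> PiE Cs F"
    \<comment> \<open>Surjectivity: the chosen permutations are glued, each point being moved by the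
      one belonging to its block.\<close>
    define block where "block x = (THE C. C \<in> Cs \<and> x \<in> C)" for x
    have block: "block x = C" if "C \<in> Cs" "x \<in> C" for x C
      unfolding block_def using that uniq by (intro the_equality) auto
    define \<beta> where "\<beta> x = (if x \<in> S then w (block x) x else x)" for x
    have wC: "w C permutes C" if "C \<in> Cs" for C
      using assms(3)[OF that] w that by (auto simp: PiE_def Pi_def)
    have \<beta>C: "\<beta> x = w C x" if "C \<in> Cs" "x \<in> C" for x C
      using block[OF that] that part(1) by (auto simp: \<beta>_def)
    have in_C: "\<beta> x \<in> C" if "C \<in> Cs" "x \<in> C" for x C
      using \<beta>C[OF that] wC[OF that(1)] that(2) by (simp add: permutes_in_image)
    have "\<beta> permutes S"
    proof (rule bij_imp_permutes)
      have "inj_on \<beta> S"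
      proof (rule inj_onI)
        fix x y assume "x \<in> S" "y \<in> S" and eq: "\<beta> x = \<beta> y"
        then obtain C D where CD: "C \<in> Cs" "x \<in> C" "D \<in> Cs" "y \<in> D" using part(1) by blast
        then have "C = D" using in_C eq uniq by metis
        then show "x = y" using CD \<beta>C eq permutes_inj[OF wC[OF CD(1)]] by (metis injD)
      qed
      moreover have "\<beta> ` S \<subseteq> S" using in_C part(1) by blast
      ultimately show "bij_betw \<beta> S S" using assms(2) by (simp add: bij_betw_def endo_inj_surj)
    qed (simp add: \<beta>_def)
    moreover have restr: "perm_restrict \<beta> C = w C" if "C \<in> Cs" for C
      using \<beta>C[OF that] wC[OF that] by (auto simp: perm_restrict_def permutes_not_in fun_eq_iff)
    ultimately have "\<beta> \<in> ?A" using w by (auto simp: PiE_def Pi_def)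
    moreover have "w = (\<lambda>C\<in>Cs. perm_restrict \<beta> C)"
      using w restr by (auto simp: fun_eq_iff PiE_def extensional_def)
    ultimately show "\<exists>\<beta>\<in>?A. w = (\<lambda>C\<in>Cs. perm_restrict \<beta> C)" by blast
  qed
  then have "card ?A = card (PiE Cs F)" by (rule bij_betw_same_card)
  then show ?thesis using card_PiE[OF fin] by simp
qed

text \<open>An invariant coloring is a free choice of one color for each cycle of \<rho>. The
  injection \<open>e\<close> lets the colored objects be arcs while \<rho> permutes their
  indices.\<close>

lemma card_invariant_colorings:
  assumes "\<rho> permutes S" "finite S" "inj_on e S"
  shows "card {col \<in> e ` S \<rightarrow>\<^sub>E T. \<forall>i\<in>S. col (e (\<rho> i)) = col (e i)} = card T ^ num_cycles S \<rho>"
proof -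
  let ?A = "{col \<in> e ` S \<rightarrow>\<^sub>E T. \<forall>i\<in>S. col (e (\<rho> i)) = col (e i)}"
  let ?h = "\<lambda>d. \<lambda>x\<in>e ` S. d (orbit \<rho> (inv_into S e x))"
  have perm: "permutation \<rho>" using assms(1,2) permutation_permutes by blast
  have inv: "inv_into S e (e i) = i" if "i \<in> S" for i using assms(3) that by simp
  have "bij_betw ?h (perm_cycles S \<rho> \<rightarrow>\<^sub>E T) ?A"
  proof (rule bij_betwI')
    fix d d' assume d: "d \<in> perm_cycles S \<rho> \<rightarrow>\<^sub>E T" "d' \<in> perm_cycles S \<rho> \<rightarrow>\<^sub>E T"
    show "?h d = ?h d' \<longleftrightarrow> d = d'"
    proof
      assume eq: "?h d = ?h d'"
      show "d = d'"
      proof (rule PiE_ext[OF d])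
        fix C assume "C \<in> perm_cycles S \<rho>"
        then obtain i where i: "i \<in> S" "C = orbit \<rho> i" by (auto simp: perm_cycles_def)
        then show "d C = d' C" using fun_cong[OF eq, of "e i"] by (simp add: inv)
      qed
    qed simp
  next
    fix d assume d: "d \<in> perm_cycles S \<rho> \<rightarrow>\<^sub>E T"
    have "?h d \<in> e ` S \<rightarrow>\<^sub>E T" using d by (auto simp: perm_cycles_def inv)
    moreover have "?h d (e (\<rho> i)) = ?h d (e i)" if "i \<in> S" for i
      using that permutes_in_image[OF assms(1)] by (simp add: inv permutation_orbit_step[OF perm])
    ultimately show "?h d \<in> ?A" by blast
  next
    fix col assume "col \<in> ?A"
    then have col: "col \<in> e ` S \<rightarrow>\<^sub>E T" "\<And>i. i \<in> S \<Longrightarrow> col (e (\<rho> i)) = col (e i)" by auto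
    have const: "col (e j) = col (e i)" if "j \<in> orbit \<rho> i" "i \<in> S" for i j
      using that(1)
    proof induction
      case base
      show ?case using col(2)[OF that(2)] .
    next
      case (step j)
      then have "j \<in> S" using permutes_orbit_subset[OF assms(1) that(2)] by blast
      then show ?case using col(2) step by simp
    qed
    \<comment> \<open>By \<open>const\<close>, the color does not depend on the chosen
      representative.\<close>
    define d where "d = (\<lambda>C\<in>perm_cycles S \<rho>. col (e (SOME j. j \<in> C)))"
    have d: "d (orbit \<rho> i) = col (e i)" if "i \<in> S" for i
    proof -
      have "(SOME j. j \<in> orbit \<rho> i) \<in> orbit \<rho> i"
        using permutation_self_in_orbit[OF perm, of i] by (rule someI)
      then show ?thesis using const that by (simp add: d_def perm_cycles_def)
    qed
    have "d \<in> perm_cycles S \<rho> \<rightarrow>\<^sub>E T"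
    proof (rule PiE_I)
      fix C assume "C \<in> perm_cycles S \<rho>"
      then obtain i where "i \<in> S" "C = orbit \<rho> i" by (auto simp: perm_cycles_def)
      then show "d C \<in> T" using d col(1) by auto
    qed (simp add: d_def)
    moreover have "col = ?h d"
    proof
      fix x
      show "col x = ?h d x"
        using col(1) by (cases "x \<in> e ` S") (auto simp: inv d PiE_def extensional_def)
    qed
    ultimately show "\<exists>d\<in>perm_cycles S \<rho> \<rightarrow>\<^sub>E T. col = ?h d" by blast
  qed
  from bij_betw_same_card[OF this] have "card ?A = card (perm_cycles S \<rho> \<rightarrow>\<^sub>E T)" by (rule sym)
  then show ?thesis using assms(2) by (simp add: card_PiE num_cycles_def perm_cycles_def)
qed

section \<open>Medial vertices and valences\<close>

definition medial_cycle :: "nat set \<Rightarrow> medial_point set" where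
  "medial_cycle C = Neg ` C \<union> Pos ` C"

lemma in_medial_cycle [simp]:
  "Neg i \<in> medial_cycle C \<longleftrightarrow> i \<in> C" "Pos i \<in> medial_cycle C \<longleftrightarrow> i \<in> C"
  by (auto simp: medial_cycle_def)

lemma finite_medial_cycle: "finite C \<Longrightarrow> finite (medial_cycle C)"
  by (simp add: medial_cycle_def)

lemma card_medial_cycle:
  assumes "finite C"
  shows "card (medial_cycle C) = 2 * card C"
proof -
  have "card (Neg ` C) = card C" "card (Pos ` C) = card C"
    by (auto intro!: card_image inj_onI)
  moreover have "Neg ` C \<inter> Pos ` C = {}" by auto
  ultimately show ?thesis
    using assms by (simp add: medial_cycle_def card_Un_disjoint)
qed

lemma inj_medial_cycle: "inj medial_cycle"
proof (rule injI)
  fix C D assume "medial_cycle C = medial_cycle D"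
  then have "i \<in> C \<longleftrightarrow> i \<in> D" for i by (metis in_medial_cycle(1))
  then show "C = D" by blast
qed

text \<open>Two steps of the rotation take \<open>Pos i\<close> through
  \<open>Neg (\<alpha> i)\<close> to \<open>Pos (\<alpha> i)\<close>, so a vertex consists of both
  copies of a cycle of \<alpha>.\<close>

lemma orbit_medial_vertex_perm:
  assumes "\<alpha> permutes {1..n}" "i \<in> {1..n}"
  shows "orbit (medial_vertex_perm n \<alpha>) (Pos i) = medial_cycle (orbit \<alpha> i)"
    and "orbit (medial_vertex_perm n \<alpha>) (Neg i) = medial_cycle (orbit \<alpha> i)"
proof -
  let ?s = "medial_vertex_perm n \<alpha>"
  have perm: "permutation \<alpha>" using assms(1) permutation_permutes by blast
  have sub: "orbit \<alpha> i \<subseteq> {1..n}" using assms by (rule permutes_orbit_subset)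
  have "?s ` medial_cycle (orbit \<alpha> i) \<subseteq> medial_cycle (orbit \<alpha> i)"
  proof (rule image_subsetI)
    fix x assume x: "x \<in> medial_cycle (orbit \<alpha> i)"
    show "?s x \<in> medial_cycle (orbit \<alpha> i)"
    proof (cases x)
      case (Neg j)
      then show ?thesis using x sub by auto
    next
      case (Pos j)
      then show ?thesis using x subsetD[OF sub, of j] orbit.step[of j \<alpha> i] by simp
    qed
  qed
  then have "orbit ?s (Pos i) \<subseteq> medial_cycle (orbit \<alpha> i)"
    using permutation_self_in_orbit[OF perm] by (intro orbit_subset_invariant) auto
  moreover have "Neg j \<in> orbit ?s (Pos i) \<and> Pos j \<in> orbit ?s (Pos i)" if "j \<in> orbit \<alpha> i" for j
    using that
  proof induction
    case base
    have "Neg (\<alpha> i) = ?s (Pos i)" using assms(2) by simp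
    then have "Neg (\<alpha> i) \<in> orbit ?s (Pos i)" by (rule orbit_eqI)
    moreover have "Pos (\<alpha> i) = ?s (Neg (\<alpha> i))" using assms permutes_in_image[OF assms(1)] by simp
    ultimately show ?case by (blast intro: orbit_eqI(2))
  next
    case (step j)
    then have j: "j \<in> {1..n}" using sub by blast
    have "Neg (\<alpha> j) = ?s (Pos j)" using j by simp
    then have "Neg (\<alpha> j) \<in> orbit ?s (Pos i)" using step by (blast intro: orbit_eqI(2))
    moreover have "Pos (\<alpha> j) = ?s (Neg (\<alpha> j))" using j permutes_in_image[OF assms(1)] by simp
    ultimately show ?case by (blast intro: orbit_eqI(2))
  qed
  ultimately show *: "orbit ?s (Pos i) = medial_cycle (orbit \<alpha> i)"
    by (auto simp: medial_cycle_def)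
  have "Pos i = ?s (Neg i)" using assms(2) by simp
  moreover have "Neg i \<in> orbit ?s (Pos i)" unfolding * using permutation_self_in_orbit[OF perm] by simp
  ultimately show "orbit ?s (Neg i) = medial_cycle (orbit \<alpha> i)"
    using * orbit_subset self_in_orbit_step by metis
qed

lemma perm_cycles_medial_vertex_perm:
  assumes "\<alpha> permutes {1..n}"
  shows "perm_cycles (medial_points n) (medial_vertex_perm n \<alpha>) = medial_cycle ` perm_cycles {1..n} \<alpha>"
  using orbit_medial_vertex_perm[OF assms]
  by (simp add: perm_cycles_def medial_points_def image_Un image_image)

lemma perm_cycle_finite_subset:
  fixes \<alpha> :: "nat \<Rightarrow> nat"
  assumes "\<alpha> permutes {1..n}" "C \<in> perm_cycles {1..n} \<alpha>"
  shows "C \<subseteq> {1..n}" "finite C"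
proof -
  show "C \<subseteq> {1..n}" using assms(2) permutes_orbit_subset[OF assms(1)] unfolding perm_cycles_def by blast
  then show "finite C" by (rule finite_subset[OF _ finite_atLeastAtMost])
qed

lemma medial_cycle_cyclic_on:
  assumes "\<alpha> permutes {1..n}" "C \<in> perm_cycles {1..n} \<alpha>"
  shows "cyclic_on (medial_vertex_perm n \<alpha>) (medial_cycle C)"
proof -
  obtain i where i: "i \<in> {1..n}" "C = orbit \<alpha> i" using assms(2) by (auto simp: perm_cycles_def)
  have "i \<in> C" using assms(1) i by (metis finite_atLeastAtMost permutation_permutes permutation_self_in_orbit)
  then show ?thesis
    using orbit_medial_vertex_perm(1)[OF assms(1) i(1)] i(2)
    by (intro cyclic_on_singleI[of "Pos i"]) simp_all
qed

text \<open>The rotation turns all vertices at once, whereas the criterion for a single cycle asks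
  for a permutation supported on that cycle.\<close>

lemma medial_cycle_permutes:
  assumes "\<alpha> permutes {1..n}" "C \<in> perm_cycles {1..n} \<alpha>"
  shows "perm_restrict (medial_vertex_perm n \<alpha>) (medial_cycle C) permutes medial_cycle C"
proof (rule perm_restrict_permutes)
  note C = perm_cycle_finite_subset[OF assms]
  show "finite (medial_cycle C)" using C by (simp add: finite_medial_cycle)
  show "inj_on (medial_vertex_perm n \<alpha>) (medial_cycle C)"
  proof (rule inj_onI)
    have s: "medial_vertex_perm n \<alpha> (Neg i) = Pos i" "medial_vertex_perm n \<alpha> (Pos i) = Neg (\<alpha> i)"
      if "i \<in> C" for i using C(1) that by auto
    fix x y assume "x \<in> medial_cycle C" "y \<in> medial_cycle C"
      "medial_vertex_perm n \<alpha> x = medial_vertex_perm n \<alpha> y"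
    then show "x = y"
      by (cases x; cases y)
        (simp_all add: s inj_eq[OF permutes_inj[OF assms(1)]] del: medial_vertex_perm.simps)
  qed
  show "medial_vertex_perm n \<alpha> ` medial_cycle C \<subseteq> medial_cycle C"
    using cyclic_on_inI[OF medial_cycle_cyclic_on[OF assms]] by blast
qed

section \<open>Matchings of one medial vertex as permutations\<close>

fun match_partner :: "nat set \<Rightarrow> (nat \<Rightarrow> nat) \<Rightarrow> medial_point \<Rightarrow> medial_point" where
  "match_partner C b (Pos i) = (if i \<in> C then Neg (b i) else Pos i)"
| "match_partner C b (Neg j) = (if j \<in> C then Pos (inv' b j) else Neg j)"

definition matching :: "nat set \<Rightarrow> (nat \<Rightarrow> nat) \<Rightarrow> medial_point set set" where
  "matching C b = (\<lambda>i. {Pos i, Neg (b i)}) ` C"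

lemma match_partner_involution:
  assumes "b permutes C"
  shows "match_partner C b (match_partner C b x) = x"
  using assms permutes_in_image[OF assms] permutes_in_image[OF permutes_inv[OF assms]]
  by (cases x) (auto simp: permutes_inverses)

lemma match_partner_permutes:
  assumes "b permutes C"
  shows "match_partner C b permutes medial_cycle C"
  unfolding permutes_def
proof (intro conjI allI impI)
  fix x assume "x \<notin> medial_cycle C"
  then show "match_partner C b x = x" by (cases x) auto
next
  fix y
  show "\<exists>!x. match_partner C b x = y"
    by (rule ex1I[of _ "match_partner C b y"]) (use match_partner_involution[OF assms] in auto)
qed

lemma match_partner_neq: "x \<in> medial_cycle C \<Longrightarrow> match_partner C b x \<noteq> x"
  by (cases x) auto

lemma doubleton_in_matching_iff:
  assumes "b permutes C" "x \<in> medial_cycle C"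
  shows "{x, y} \<in> matching C b \<longleftrightarrow> match_partner C b x = y"
  using assms(2) permutes_in_image[OF permutes_inv[OF assms(1)]]
  by (cases x) (auto simp: matching_def doubleton_eq_iff image_iff permutes_inverses[OF assms(1)])

text \<open>A vertex has \<open>2 * card C\<close> points, so the maximal count for a perfect
  matching is \<open>card C + 1\<close>. This is the constant in the definition of
  refinement.\<close>

lemma noncrossing_matching_iff:
  assumes "\<alpha> permutes {1..n}" "C \<in> perm_cycles {1..n} \<alpha>" "b permutes C"
  shows "noncrossing (medial_vertex_perm n \<alpha>) (medial_cycle C) (matching C b) \<longleftrightarrow>
    num_cycles C b + num_cycles C (inv' b \<circ> perm_restrict \<alpha> C) = card C + 1"
proof -
  let ?V = "medial_cycle C" and ?s = "medial_vertex_perm n \<alpha>" and ?\<mu> = "match_partner C b"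
  let ?s' = "perm_restrict ?s ?V"
  note C = perm_cycle_finite_subset[OF assms(1,2)]
  note cyc = medial_cycle_cyclic_on[OF assms(1,2)]
  have cyc': "cyclic_on ?s' ?V" using cyc by (simp add: cyclic_on_perm_restrict)
  have fin: "finite ?V" using C by (simp add: finite_medial_cycle)
  have \<alpha>C: "perm_restrict \<alpha> C permutes C"
    by (rule perm_restrict_perm_cycle_permutes[OF assms(1) _ assms(2)]) simp
  have pow: "(?s ^^ i) x = (?s' ^^ i) x" if "x \<in> ?V" for i x
  proof (induction i)
    case (Suc i)
    then show ?case using cyclic_on_funpow_in[OF cyc' that, of i] by (simp add: perm_restrict_simps)
  qed simp
  let ?g = "?s' \<circ> ?\<mu>" and ?\<gamma> = "inv' b \<circ> perm_restrict \<alpha> C"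
  have b_in: "b x \<in> C" if "x \<in> C" for x using permutes_in_image[OF assms(3)] that by simp
  have \<gamma>: "?\<gamma> permutes C" by (intro permutes_compose permutes_inv \<alpha>C assms(3))
  have g_Pos: "?g (Pos x) = Pos (b x)" if "x \<in> C" for x
    using that b_in[OF that] C(1) by (auto simp: perm_restrict_simps)
  \<comment> \<open>Labelling the negative points by \<open>Neg (b x)\<close> makes the action
    exactly \<open>?\<gamma>\<close>; with the labels \<open>Neg x\<close> it would be the conjugate
    \<open>\<alpha> \<circ> inv' b\<close>.\<close>
  have g_Neg: "?g ((Neg \<circ> b) x) = (Neg \<circ> b) (?\<gamma> x)" if "x \<in> C" for x
    using that b_in[OF that] C(1) by (auto simp: perm_restrict_simps permutes_inverses[OF assms(3)])
  have "(Neg \<circ> b) ` C = Neg ` C" using permutes_image[OF assms(3)] by (metis image_comp)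
  then have "?V = (Neg \<circ> b) ` C \<union> Pos ` C" by (simp only: medial_cycle_def)
  then have "num_cycles ?V ?g = num_cycles ((Neg \<circ> b) ` C \<union> Pos ` C) ?g"
    by (rule arg_cong[where f = "\<lambda>V. num_cycles V ?g"])
  also have "num_cycles ((Neg \<circ> b) ` C \<union> Pos ` C) ?g =
      num_cycles ((Neg \<circ> b) ` C) ?g + num_cycles (Pos ` C) ?g"
  proof (rule num_cycles_Un_disjoint)
    show "?g ` (Neg \<circ> b) ` C \<subseteq> (Neg \<circ> b) ` C"
    proof (rule image_subsetI, elim imageE)
      fix y x assume "x \<in> C" "y = (Neg \<circ> b) x"
      then have "?g y = (Neg \<circ> b) (?\<gamma> x)" using g_Neg by blast
      moreover have "?\<gamma> x \<in> C" using permutes_in_image[OF \<gamma>] \<open>x \<in> C\<close> by blast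
      ultimately show "?g y \<in> (Neg \<circ> b) ` C" by (rule image_eqI)
    qed
    show "?g ` Pos ` C \<subseteq> Pos ` C"
    proof (rule image_subsetI, elim imageE)
      fix y x assume "x \<in> C" "y = Pos x"
      then have "?g y = Pos (b x)" using g_Pos by blast
      then show "?g y \<in> Pos ` C" using b_in[OF \<open>x \<in> C\<close>] by (rule image_eqI)
    qed
  qed (use C in auto)
  also have "num_cycles ((Neg \<circ> b) ` C) ?g = num_cycles C ?\<gamma>"
  proof (rule num_cycles_image[where h = "Neg \<circ> b" and g = ?g and f = ?\<gamma>, OF \<gamma> C(2)])
    show "inj_on (Neg \<circ> b) C"
      by (rule comp_inj_on[OF permutes_inj_on[OF assms(3)]], rule inj_onI, simp)
  qed (rule g_Neg)
  also have "num_cycles (Pos ` C) ?g = num_cycles C b"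
  proof (rule num_cycles_image[where h = Pos and g = ?g and f = b, OF assms(3) C(2)])
    show "inj_on Pos C" by (auto intro!: inj_onI)
  qed (rule g_Pos)
  finally have z: "num_cycles ?V ?g = num_cycles C ?\<gamma> + num_cycles C b" .
  have "noncrossing ?s ?V (matching C b) \<longleftrightarrow> crossing_free ?s' ?V ?\<mu>"
    unfolding noncrossing_def crossing_free_def
    using cyclic_on_funpow_in[OF cyc] doubleton_in_matching_iff[OF assms(3)] pow
    by (metis (no_types, lifting))
  also have "\<dots> \<longleftrightarrow> 2 * num_cycles ?V (?s' \<circ> ?\<mu>) = card ?V + 2"
    by (rule crossing_free_iff_num_cycles[OF fin match_partner_permutes[OF assms(3)]
      match_partner_involution[OF assms(3)] match_partner_neq
      medial_cycle_permutes[OF assms(1,2)] cyc'])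
  also have "\<dots> \<longleftrightarrow> num_cycles C b + num_cycles C ?\<gamma> = card C + 1"
    unfolding z card_medial_cycle[OF C(2)] by auto
  finally show ?thesis .
qed

lemma coherent_matching_iff:
  assumes "finite C"
  shows "coherent_matching s (medial_cycle C) P \<longleftrightarrow>
    (\<exists>b. b permutes C \<and> P = matching C b \<and> noncrossing s (medial_cycle C) P)"
proof
  assume "\<exists>b. b permutes C \<and> P = matching C b \<and> noncrossing s (medial_cycle C) P"
  then obtain b where b: "b permutes C" "P = matching C b" "noncrossing s (medial_cycle C) P" by blast
  have "partition_on (medial_cycle C) (matching C b)"
  proof (rule partition_onI)
    have "\<Union> (matching C b) = Pos ` C \<union> Neg ` b ` C" by (auto simp: matching_def)
    then show "\<Union> (matching C b) = medial_cycle C"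
      using permutes_image[OF b(1)] by (simp add: medial_cycle_def Un_commute)
    show "disjnt p q" if "p \<in> matching C b" "q \<in> matching C b" "p \<noteq> q" for p q
      using that permutes_inj[OF b(1)] by (auto simp: matching_def disjnt_def inj_def)
  qed (auto simp: matching_def)
  then show "coherent_matching s (medial_cycle C) P"
    using b by (auto simp: coherent_matching_def matching_def)
next
  assume coh: "coherent_matching s (medial_cycle C) P"
  then have part: "partition_on (medial_cycle C) P"
    and pairs: "\<And>e. e \<in> P \<Longrightarrow> \<exists>i j. e = {Pos i, Neg j}"
    and nc: "noncrossing s (medial_cycle C) P" by (auto simp: coherent_matching_def)
  have uniq: "e = f" if "e \<in> P" "f \<in> P" "x \<in> e" "x \<in> f" for e f x
    using that partition_onD2[OF part] by (auto simp: disjoint_def)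
  have ex: "\<exists>j. {Pos i, Neg j} \<in> P" if "i \<in> C" for i
  proof -
    have "Pos i \<in> \<Union>P" using that partition_onD1[OF part] by (metis in_medial_cycle(2))
    then obtain e where "e \<in> P" "Pos i \<in> e" by blast
    with pairs[of e] show ?thesis by auto
  qed
  \<comment> \<open>The blocks are disjoint, so the choice is forced on \<open>C\<close>; outside
    \<open>C\<close> the value must be \<open>i\<close> for a permutation of
    \<open>C\<close>.\<close>
  define b where "b i = (if i \<in> C then SOME j. {Pos i, Neg j} \<in> P else i)" for i
  have b: "{Pos i, Neg (b i)} \<in> P" if "i \<in> C" for i
    using someI_ex[OF ex[OF that]] that by (simp add: b_def)
  have sub: "i \<in> C \<and> j \<in> C" if "{Pos i, Neg j} \<in> P" for i j
  proof -
    have "{Pos i, Neg j} \<subseteq> medial_cycle C" using that partition_onD1[OF part] by blast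
    then show ?thesis by simp
  qed
  have "b permutes C"
  proof (rule bij_imp_permutes)
    have "inj_on b C"
    proof (rule inj_onI)
      fix x y assume "x \<in> C" "y \<in> C" "b x = b y"
      then have "{Pos x, Neg (b x)} = {Pos y, Neg (b y)}"
        using b[of x] b[of y] by (intro uniq[of _ _ "Neg (b x)"]) auto
      then show "x = y" by (auto simp: doubleton_eq_iff)
    qed
    moreover have "b ` C \<subseteq> C" using b sub by blast
    ultimately show "bij_betw b C C" using assms by (simp add: bij_betw_def endo_inj_surj)
  qed (simp add: b_def)
  moreover have "P = matching C b"
  proof
    show "matching C b \<subseteq> P" using b by (auto simp: matching_def)
    show "P \<subseteq> matching C b"
    proof
      fix e assume e: "e \<in> P"
      then obtain i j where ij: "e = {Pos i, Neg j}" using pairs by blast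
      then have "i \<in> C" using sub e by blast
      moreover from this have "e = {Pos i, Neg (b i)}"
        using b e ij by (intro uniq[of _ _ "Pos i"]) auto
      ultimately show "e \<in> matching C b" by (auto simp: matching_def)
    qed
  qed
  ultimately show "\<exists>b. b permutes C \<and> P = matching C b \<and> noncrossing s (medial_cycle C) P"
    using nc by blast
qed

lemma inj_on_matching: "inj_on (matching C) {b. b permutes C}"
proof (rule inj_onI, rule ext)
  fix b b' x assume b: "b \<in> {b. b permutes C}" "b' \<in> {b. b permutes C}" and eq: "matching C b = matching C b'"
  show "b x = b' x"
  proof (cases "x \<in> C")
    case True
    then have "{Pos x, Neg (b x)} \<in> matching C b'" unfolding eq[symmetric] by (auto simp: matching_def)
    then show ?thesis by (auto simp: matching_def doubleton_eq_iff)
  next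
    case False
    then show ?thesis using b by (simp add: permutes_not_in)
  qed
qed

text \<open>Restates the valence as a number of permutations of one block, so that a product over
  vertices can be assembled into a number of permutations of \<open>{1..n}\<close>.\<close>

lemma valence_medial_cycle:
  assumes "\<alpha> permutes {1..n}" "C \<in> perm_cycles {1..n} \<alpha>"
  shows "valence (medial_vertex_perm n \<alpha>) (medial_cycle C) pcol =
    card {b. b permutes C \<and>
      num_cycles C b + num_cycles C (inv' b \<circ> perm_restrict \<alpha> C) = card C + 1 \<and>
      (\<forall>i\<in>C. pcol (Pos i) = pcol (Neg (b i)))}" (is "_ = card ?B")
proof -
  note C = perm_cycle_finite_subset[OF assms]
  have mono_iff: "(\<forall>e \<in> matching C b. \<forall>p \<in> e. \<forall>q \<in> e. pcol p = pcol q) \<longleftrightarrow>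
      (\<forall>i\<in>C. pcol (Pos i) = pcol (Neg (b i)))" for b
  proof (intro iffI ballI)
    fix i assume *: "\<forall>e \<in> matching C b. \<forall>p \<in> e. \<forall>q \<in> e. pcol p = pcol q" and "i \<in> C"
    then have "{Pos i, Neg (b i)} \<in> matching C b" by (simp add: matching_def)
    from *[rule_format, OF this, of "Pos i" "Neg (b i)"] show "pcol (Pos i) = pcol (Neg (b i))" by simp
  next
    fix e p q assume *: "\<forall>i\<in>C. pcol (Pos i) = pcol (Neg (b i))" and e: "e \<in> matching C b" "p \<in> e" "q \<in> e"
    from e(1) obtain i where i: "i \<in> C" "e = {Pos i, Neg (b i)}" unfolding matching_def by blast
    then have "pcol x = pcol (Pos i)" if "x \<in> e" for x
      using that bspec[OF * i(1)] by (metis insertE singletonD)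
    then show "pcol p = pcol q" using e by metis
  qed
  have "{P. coherent_matching (medial_vertex_perm n \<alpha>) (medial_cycle C) P \<and>
      (\<forall>e \<in> P. \<forall>p \<in> e. \<forall>q \<in> e. pcol p = pcol q)} = matching C ` ?B" (is "?A = _")
  proof
    show "?A \<subseteq> matching C ` ?B"
    proof
      fix P assume "P \<in> ?A"
      then have coh: "coherent_matching (medial_vertex_perm n \<alpha>) (medial_cycle C) P"
        and col: "\<forall>e \<in> P. \<forall>p \<in> e. \<forall>q \<in> e. pcol p = pcol q" by blast+
      obtain b where b: "b permutes C" "P = matching C b"
        "noncrossing (medial_vertex_perm n \<alpha>) (medial_cycle C) (matching C b)"
        using coh unfolding coherent_matching_iff[OF C(2)] by blast
      have "b \<in> ?B"
        using b(1,3) col[unfolded b(2) mono_iff] noncrossing_matching_iff[OF assms b(1)] by blast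
      then show "P \<in> matching C ` ?B" using b(2) by blast
    qed
    show "matching C ` ?B \<subseteq> ?A"
    proof
      fix P assume "P \<in> matching C ` ?B"
      then obtain b where b: "b \<in> ?B" "P = matching C b" by blast
      then have "noncrossing (medial_vertex_perm n \<alpha>) (medial_cycle C) P"
        using noncrossing_matching_iff[OF assms, of b] by simp
      then have "coherent_matching (medial_vertex_perm n \<alpha>) (medial_cycle C) P"
        unfolding coherent_matching_iff[OF C(2)] using b by blast
      moreover have "\<forall>e \<in> P. \<forall>p \<in> e. \<forall>q \<in> e. pcol p = pcol q"
        using b(1) unfolding b(2) mono_iff by blast
      ultimately show "P \<in> ?A" by blast
    qed
  qed
  moreover have "inj_on (matching C) ?B"
    by (rule inj_on_subset[OF inj_on_matching]) auto
  ultimately show ?thesis unfolding valence_def by (simp add: card_image)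
qed

section \<open>Medial edges and Eulerian colorings\<close>

text \<open>Indexing an arc by the label of its positive endpoint lets permutations of
  \<open>{1..n}\<close> act on the arcs.\<close>

definition medial_edge :: "(nat \<Rightarrow> nat) \<Rightarrow> nat \<Rightarrow> medial_point set" where
  "medial_edge \<sigma> i = {Pos i, Neg (\<sigma> i)}"

lemma inj_medial_edge: "inj (medial_edge \<sigma>)"
  by (auto simp: medial_edge_def inj_def doubleton_eq_iff)

lemma orbit_involution:
  assumes "f (f x) = x"
  shows "orbit f x = {x, f x}"
proof -
  have "(f ^^ 2) x = x" using assms by (simp add: numeral_2_eq_2)
  from orbit_altdef_bounded[OF this] have "orbit f x = {(f ^^ k) x | k. k < 2}" by simp
  also have "\<dots> = (\<lambda>k. (f ^^ k) x) ` {..<2}" by auto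
  also have "{..<2} = {0, 1 :: nat}" by auto
  finally show ?thesis by simp
qed

lemma orbit_medial_edge_perm:
  assumes "\<sigma> permutes {1..n}" "i \<in> {1..n}"
  shows "orbit (medial_edge_perm n \<sigma>) (Pos i) = medial_edge \<sigma> i"
    and "orbit (medial_edge_perm n \<sigma>) (Neg i) = medial_edge \<sigma> (inv' \<sigma> i)"
proof -
  let ?e = "medial_edge_perm n \<sigma>"
  have "\<sigma> i \<in> {1..n}" using permutes_in_image[OF assms(1)] assms(2) by blast
  then have "?e (?e (Pos i)) = Pos i" "?e (Pos i) = Neg (\<sigma> i)"
    using assms(2) permutes_inverses[OF assms(1)] by simp_all
  then show "orbit ?e (Pos i) = medial_edge \<sigma> i"
    by (simp add: orbit_involution medial_edge_def)
  have "inv' \<sigma> i \<in> {1..n}" using permutes_in_image[OF permutes_inv[OF assms(1)]] assms(2) by blast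
  then have "?e (?e (Neg i)) = Neg i" "?e (Neg i) = Pos (inv' \<sigma> i)"
    using assms(2) permutes_inverses[OF assms(1)] by simp_all
  then show "orbit ?e (Neg i) = medial_edge \<sigma> (inv' \<sigma> i)"
    by (simp add: orbit_involution medial_edge_def permutes_inverses[OF assms(1)] insert_commute)
qed

lemma perm_cycles_medial_edge_perm:
  assumes "\<sigma> permutes {1..n}"
  shows "perm_cycles (medial_points n) (medial_edge_perm n \<sigma>) = medial_edge \<sigma> ` {1..n}"
proof -
  have "perm_cycles (medial_points n) (medial_edge_perm n \<sigma>) =
      medial_edge \<sigma> ` inv' \<sigma> ` {1..n} \<union> medial_edge \<sigma> ` {1..n}"
    using orbit_medial_edge_perm[OF assms]
    by (simp add: perm_cycles_def medial_points_def image_Un image_image)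
  then show ?thesis using permutes_image[OF permutes_inv[OF assms]] by simp
qed

lemma medial_digraph_simps:
  assumes "\<sigma> permutes {1..n}" "\<alpha> permutes {1..n}"
  defines "G \<equiv> medial_digraph n (medial_vertex_perm n \<alpha>, medial_edge_perm n \<sigma>)"
  shows "arcs G = medial_edge \<sigma> ` {1..n}"
    and "i \<in> {1..n} \<Longrightarrow> tail G (medial_edge \<sigma> i) = medial_cycle (orbit \<alpha> i)"
    and "i \<in> {1..n} \<Longrightarrow> head G (medial_edge \<sigma> i) = medial_cycle (orbit \<alpha> (\<sigma> i))"
proof -
  show "arcs G = medial_edge \<sigma> ` {1..n}"
    by (simp add: G_def medial_digraph_def perm_cycles_medial_edge_perm[OF assms(1)])
next
  assume i: "i \<in> {1..n}"
  have "(THE p. p \<in> medial_edge \<sigma> i \<and> p \<in> range Pos) = Pos i"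
    by (rule the_equality) (auto simp: medial_edge_def)
  then show "tail G (medial_edge \<sigma> i) = medial_cycle (orbit \<alpha> i)"
    using orbit_medial_vertex_perm(1)[OF assms(2) i] by (simp add: G_def medial_digraph_def)
  have "(THE p. p \<in> medial_edge \<sigma> i \<and> p \<in> range Neg) = Neg (\<sigma> i)"
    by (rule the_equality) (auto simp: medial_edge_def)
  moreover have "\<sigma> i \<in> {1..n}" using i permutes_in_image[OF assms(1)] by blast
  ultimately show "head G (medial_edge \<sigma> i) = medial_cycle (orbit \<alpha> (\<sigma> i))"
    using orbit_medial_vertex_perm(2)[OF assms(2)] by (simp add: G_def medial_digraph_def)
qed

lemma refines_orbit_eq:
  assumes "refines n \<beta> \<alpha>" "\<alpha> permutes {1..n}" "i \<in> {1..n}"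
  shows "orbit \<alpha> (\<beta> i) = orbit \<alpha> i"
proof -
  have perm: "permutation \<alpha>" using assms(2) permutation_permutes by blast
  have "perm_restrict \<beta> (orbit \<alpha> i) permutes orbit \<alpha> i"
    using assms(1,3) by (auto simp: refines_def perm_cycles_def)
  moreover have "i \<in> orbit \<alpha> i" by (rule permutation_self_in_orbit[OF perm])
  ultimately have "\<beta> i \<in> orbit \<alpha> i"
    by (metis perm_restrict_simps(1) permutes_in_image)
  then show ?thesis by (rule orbit_cyclic_eq3[OF cyclic_on_orbit'[OF perm]])
qed

text \<open>The matching joins the arc leaving through \<open>Pos i\<close> to the arc entering
  through \<open>Neg (\<beta> i)\<close>, whose index is
  \<open>(inv' \<sigma> \<circ> \<beta>) i\<close>. At every vertex this is a color-preserving
  bijection from outgoing to incoming arcs.\<close>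

lemma matching_coloring_eulerian:
  assumes "\<sigma> permutes {1..n}" "\<alpha> permutes {1..n}" "refines n \<beta> \<alpha>"
    and "col \<in> medial_edge \<sigma> ` {1..n} \<rightarrow>\<^sub>E {1..m}"
    and inv_col: "\<And>i. i \<in> {1..n} \<Longrightarrow>
      col (medial_edge \<sigma> ((inv' \<sigma> \<circ> \<beta>) i)) = col (medial_edge \<sigma> i)"
  shows "col \<in> eulerian_colorings m (medial_digraph n (medial_vertex_perm n \<alpha>, medial_edge_perm n \<sigma>))"
proof -
  let ?S = "{1..n}" and ?G = "medial_digraph n (medial_vertex_perm n \<alpha>, medial_edge_perm n \<sigma>)"
  note G = medial_digraph_simps[OF assms(1,2)]
  let ?\<rho> = "inv' \<sigma> \<circ> \<beta>" and ?e = "medial_edge \<sigma>"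
  have \<rho>: "?\<rho> permutes ?S"
    using assms(1,3) unfolding refines_def by (blast intro: permutes_compose permutes_inv)
  have head_\<rho>: "head ?G (?e (?\<rho> i)) = tail ?G (?e i)" if "i \<in> ?S" for i
  proof -
    have "?\<rho> i \<in> ?S" using permutes_in_image[OF \<rho>] that by blast
    then have "head ?G (?e (?\<rho> i)) = medial_cycle (orbit \<alpha> (\<sigma> (?\<rho> i)))" by (rule G(3))
    also have "\<sigma> (?\<rho> i) = \<beta> i" by (simp add: permutes_inverses[OF assms(1)])
    finally show ?thesis using G(2)[OF that] refines_orbit_eq[OF assms(3,2) that] by simp
  qed
  have "in_degree (?G\<lparr>arcs := {e \<in> arcs ?G. col e = c}\<rparr>) v =
      out_degree (?G\<lparr>arcs := {e \<in> arcs ?G. col e = c}\<rparr>) v" for c v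
  proof -
    let ?I = "{i \<in> ?S. col (?e i) = c \<and> head ?G (?e i) = v}"
    let ?O = "{i \<in> ?S. col (?e i) = c \<and> tail ?G (?e i) = v}"
    have "?I = ?\<rho> ` ?O"
    proof
      show "?\<rho> ` ?O \<subseteq> ?I"
      proof
        fix j assume "j \<in> ?\<rho> ` ?O"
        then obtain i where "i \<in> ?O" "j = ?\<rho> i" by blast
        then show "j \<in> ?I"
          using inv_col[of i] head_\<rho>[of i] permutes_in_image[OF \<rho>, of i] by simp
      qed
      show "?I \<subseteq> ?\<rho> ` ?O"
      proof
        fix j assume j: "j \<in> ?I"
        then have "j \<in> ?\<rho> ` ?S" using permutes_image[OF \<rho>] by blast
        then obtain i where i: "i \<in> ?S" "j = ?\<rho> i" by blast
        then have "i \<in> ?O" using j inv_col[of i] head_\<rho>[of i] by simp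
        then show "j \<in> ?\<rho> ` ?O" using i(2) by blast
      qed
    qed
    then have "card ?I = card (?\<rho> ` ?O)" by (rule arg_cong)
    also have "\<dots> = card ?O" by (rule card_image[OF inj_on_subset[OF permutes_inj[OF \<rho>] subset_UNIV]])
    finally have "card ?I = card ?O" .
    moreover have "in_arcs (?G\<lparr>arcs := {e \<in> arcs ?G. col e = c}\<rparr>) v = ?e ` ?I"
      by (auto simp: in_arcs_def G(1))
    moreover have "out_arcs (?G\<lparr>arcs := {e \<in> arcs ?G. col e = c}\<rparr>) v = ?e ` ?O"
      by (auto simp: out_arcs_def G(1))
    moreover have "card (?e ` A) = card A" for A
      by (rule card_image[OF inj_on_subset[OF inj_medial_edge subset_UNIV]])
    ultimately show ?thesis by (simp only: in_degree_def out_degree_def)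
  qed
  then show ?thesis
    using assms(4) by (simp add: eulerian_colorings_def eulerian_digraph_def G(1))
qed

text \<open>One coherent matching at each vertex amounts to one refinement, so the product of local
  counts is a global count. Equal colors at \<open>Pos i\<close> and \<open>Neg (\<beta> i)\<close>
  become invariance under \<open>inv' \<sigma> \<circ> \<beta>\<close>, because the latter point
  ends the arc with index \<open>inv' \<sigma> (\<beta> i)\<close>.\<close>

lemma prod_valence_eq_card:
  assumes "\<sigma> permutes {1..n}" "\<alpha> permutes {1..n}"
  shows "(\<Prod>v\<in>perm_cycles (medial_points n) (medial_vertex_perm n \<alpha>).
      valence (medial_vertex_perm n \<alpha>) v (induced_coloring (medial_edge_perm n \<sigma>) col)) =
    card {\<beta>. refines n \<beta> \<alpha> \<and>
      (\<forall>i\<in>{1..n}. col (medial_edge \<sigma> ((inv' \<sigma> \<circ> \<beta>) i)) = col (medial_edge \<sigma> i))}" (is "_ = card ?R")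
proof -
  let ?S = "{1..n}" and ?Cs = "perm_cycles {1..n} \<alpha>" and ?e = "medial_edge \<sigma>"
  let ?pcol = "induced_coloring (medial_edge_perm n \<sigma>) col"
  let ?F = "\<lambda>C. {b. b permutes C \<and>
      num_cycles C b + num_cycles C (inv' b \<circ> perm_restrict \<alpha> C) = card C + 1 \<and>
      (\<forall>i\<in>C. ?pcol (Pos i) = ?pcol (Neg (b i)))}"
  note part = partition_on_perm_cycles[OF assms(2) finite_atLeastAtMost]
  have pcol: "?pcol (Pos i) = col (?e i)" "?pcol (Neg i) = col (?e (inv' \<sigma> i))" if "i \<in> ?S" for i
    using orbit_medial_edge_perm[OF assms(1) that] by (simp_all add: induced_coloring_def)
  have "(\<Prod>v\<in>perm_cycles (medial_points n) (medial_vertex_perm n \<alpha>).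
      valence (medial_vertex_perm n \<alpha>) v ?pcol) = (\<Prod>C\<in>?Cs. card (?F C))"
    unfolding perm_cycles_medial_vertex_perm[OF assms(2)]
    by (subst prod.reindex[OF inj_on_subset[OF inj_medial_cycle subset_UNIV]])
      (simp add: valence_medial_cycle[OF assms(2)])
  also have "\<dots> = card {\<beta>. \<beta> permutes ?S \<and> (\<forall>C\<in>?Cs. perm_restrict \<beta> C \<in> ?F C)}"
    by (rule card_permutes_partition[OF part, symmetric]) auto
  also have "{\<beta>. \<beta> permutes ?S \<and> (\<forall>C\<in>?Cs. perm_restrict \<beta> C \<in> ?F C)} = ?R"
  proof (rule Collect_cong)
    fix \<beta>
    have "(\<forall>C\<in>?Cs. \<forall>i\<in>C. ?pcol (Pos i) = ?pcol (Neg (perm_restrict \<beta> C i))) \<longleftrightarrow>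
        (\<forall>i\<in>?S. col (?e ((inv' \<sigma> \<circ> \<beta>) i)) = col (?e i))" if "\<beta> permutes ?S"
    proof -
      have "(\<forall>C\<in>?Cs. \<forall>i\<in>C. ?pcol (Pos i) = ?pcol (Neg (perm_restrict \<beta> C i))) \<longleftrightarrow>
          (\<forall>C\<in>?Cs. \<forall>i\<in>C. ?pcol (Pos i) = ?pcol (Neg (\<beta> i)))"
        by (simp add: perm_restrict_simps)
      also have "\<dots> \<longleftrightarrow> (\<forall>i\<in>\<Union>?Cs. ?pcol (Pos i) = ?pcol (Neg (\<beta> i)))" by blast
      also have "\<Union>?Cs = ?S" using partition_onD1[OF part] by simp
      also have "(\<forall>i\<in>?S. ?pcol (Pos i) = ?pcol (Neg (\<beta> i))) \<longleftrightarrow>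
          (\<forall>i\<in>?S. col (?e ((inv' \<sigma> \<circ> \<beta>) i)) = col (?e i))"
        using pcol permutes_in_image[OF that] by (intro ball_cong) (auto simp del: atLeastAtMost_iff)
      finally show ?thesis .
    qed
    then show "(\<beta> permutes ?S \<and> (\<forall>C\<in>?Cs. perm_restrict \<beta> C \<in> ?F C)) \<longleftrightarrow>
        (refines n \<beta> \<alpha> \<and> (\<forall>i\<in>?S. col (?e ((inv' \<sigma> \<circ> \<beta>) i)) = col (?e i)))"
      unfolding refines_def mem_Collect_eq ball_conj_distrib by blast
  qed
  finally show ?thesis .
qed

section \<open>Double counting of compatible colorings and refinements\<close>

lemma sum_card_swap:
  assumes "finite A" "finite B"
  shows "(\<Sum>x\<in>A. card {y \<in> B. P x y}) = (\<Sum>y\<in>B. card {x \<in> A. P x y})"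
proof -
  have "(\<Sum>x\<in>A. card {y \<in> B. P x y}) = (\<Sum>x\<in>A. \<Sum>y\<in>B. if P x y then 1 else 0)"
    using assms(2) by (simp add: sum.If_cases Int_def)
  also have "\<dots> = (\<Sum>y\<in>B. \<Sum>x\<in>A. if P x y then 1 else 0)" by (rule sum.swap)
  also have "\<dots> = (\<Sum>y\<in>B. card {x \<in> A. P x y})"
    using assms(1) by (simp add: sum.If_cases Int_def)
  finally show ?thesis .
qed

lemma sum_eulerian_colorings_prod_valence:
  assumes "\<sigma> permutes {1..n}" "\<alpha> permutes {1..n}"
  shows "(\<Sum>col\<in>eulerian_colorings m (medial_digraph n (medial_vertex_perm n \<alpha>, medial_edge_perm n \<sigma>)).
      \<Prod>v\<in>perm_cycles (medial_points n) (medial_vertex_perm n \<alpha>).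
        valence (medial_vertex_perm n \<alpha>) v (induced_coloring (medial_edge_perm n \<sigma>) col)) =
    (\<Sum>\<beta> | refines n \<beta> \<alpha>. m ^ num_cycles {1..n} (inv' \<sigma> \<circ> \<beta>))"
proof -
  let ?S = "{1..n}" and ?R = "{\<beta>. refines n \<beta> \<alpha>}" and ?e = "medial_edge \<sigma>"
  let ?G = "medial_digraph n (medial_vertex_perm n \<alpha>, medial_edge_perm n \<sigma>)"
  let ?K = "\<lambda>col \<beta>. \<forall>i\<in>?S. col (?e ((inv' \<sigma> \<circ> \<beta>) i)) = col (?e i)"
  have sub: "eulerian_colorings m ?G \<subseteq> ?e ` ?S \<rightarrow>\<^sub>E {1..m}"
    by (auto simp: eulerian_colorings_def medial_digraph_simps(1)[OF assms])
  then have finE: "finite (eulerian_colorings m ?G)"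
    by (rule finite_subset) (simp add: finite_PiE)
  have finR: "finite ?R"
    by (rule finite_subset[OF _ finite_permutations[of ?S]]) (auto simp: refines_def)
  have card: "card {col \<in> eulerian_colorings m ?G. ?K col \<beta>} = m ^ num_cycles ?S (inv' \<sigma> \<circ> \<beta>)"
    if "\<beta> \<in> ?R" for \<beta>
  proof -
    have \<beta>: "refines n \<beta> \<alpha>" using that by blast
    have \<rho>: "inv' \<sigma> \<circ> \<beta> permutes ?S"
      using assms(1) \<beta> unfolding refines_def by (blast intro: permutes_compose permutes_inv)
    \<comment> \<open>Compatibility with \<beta> forces the Eulerian condition, so for fixed \<beta>
      the count may run over all arc colorings.\<close>
    have "{col \<in> eulerian_colorings m ?G. ?K col \<beta>} = {col \<in> ?e ` ?S \<rightarrow>\<^sub>E {1..m}. ?K col \<beta>}"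
    proof (rule Collect_cong)
      fix col
      have "col \<in> eulerian_colorings m ?G" if "col \<in> ?e ` ?S \<rightarrow>\<^sub>E {1..m}" "?K col \<beta>"
        using that(2) by (intro matching_coloring_eulerian[OF assms \<beta> that(1)]) blast
      with sub show "col \<in> eulerian_colorings m ?G \<and> ?K col \<beta> \<longleftrightarrow>
          col \<in> ?e ` ?S \<rightarrow>\<^sub>E {1..m} \<and> ?K col \<beta>" by blast
    qed

    then show ?thesis
      using card_invariant_colorings[of "inv' \<sigma> \<circ> \<beta>" ?S ?e "{1..m}", OF \<rho> finite_atLeastAtMost
        inj_on_subset[OF inj_medial_edge subset_UNIV]] by simp
  qed
  have "(\<Sum>col\<in>eulerian_colorings m ?G. card {\<beta> \<in> ?R. ?K col \<beta>}) =
      (\<Sum>\<beta>\<in>?R. card {col \<in> eulerian_colorings m ?G. ?K col \<beta>})"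
    using finE finR by (rule sum_card_swap)
  with card show ?thesis by (simp add: prod_valence_eq_card[OF assms])
qed

section \<open>Comparison of exponents in the planar case\<close>

lemma planar_refinement_defect:
  assumes "planar_hypermap n \<sigma> \<alpha>" "refines n \<beta> \<alpha>"
  shows "int (num_cycles {1..n} (inv' \<sigma> \<circ> \<beta>)) =
    int n + 2 * int (kappa n \<sigma> \<beta>) - int (num_cycles {1..n} \<sigma>) - int (num_cycles {1..n} \<beta>)"
proof -
  let ?S = "{1..n}"
  have \<sigma>: "\<sigma> permutes ?S" and \<alpha>: "\<alpha> permutes ?S" and \<beta>: "\<beta> permutes ?S"
    using assms by (auto simp: planar_hypermap_def hypermap_def hypermap_collection_def refines_def)
  have "real n + 2 = real (num_cycles ?S \<sigma> + num_cycles ?S \<alpha> + num_cycles ?S (inv' \<alpha> \<circ> \<sigma>))"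
    using assms(1) by (simp add: planar_hypermap_def genus_def)
  then have "n + 2 = num_cycles ?S \<sigma> + num_cycles ?S \<alpha> + num_cycles ?S (inv' \<alpha> \<circ> \<sigma>)" by linarith
  \<comment> \<open>Transitivity identifies the 2 of the genus formula with twice the number of
    components in \<open>defect\<close>.\<close>
  moreover have "kappa n \<sigma> \<alpha> = 1" using assms(1) by (simp add: planar_hypermap_def hypermap_def)
  ultimately have "defect ?S \<sigma> \<alpha> = 0"
    unfolding defect_def kappa_eq_num_comps[OF \<sigma> \<alpha>, symmetric]
    using num_cycles_inv_comp_swap[OF \<sigma> \<alpha> finite_atLeastAtMost] by simp
  then have "defect ?S \<sigma> \<beta> = 0"
    using defect_geodesic_eq_0[OF _ \<sigma> \<alpha> \<beta>] refines_num_cycles[OF assms(2) \<alpha>] by simp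
  then show ?thesis
    unfolding defect_def kappa_eq_num_comps[OF \<sigma> \<beta>, symmetric] by simp
qed

theorem theorem5p7:
  fixes n m :: nat
    and \<sigma> \<alpha> :: "nat \<Rightarrow> nat"
    and \<sigma>' \<alpha>' :: "medial_point \<Rightarrow> medial_point"
  assumes "planar_hypermap n \<sigma> \<alpha>"
    and "medial_map n \<sigma> \<alpha> = (\<sigma>', \<alpha>')"
    and "m > 0"
  shows "real m ^ kappa n \<sigma> \<alpha> * whitney n \<sigma> \<alpha> (real m) (real m) =
    real (\<Sum>col \<in> eulerian_colorings m (medial_digraph n (\<sigma>', \<alpha>')).
            \<Prod>v \<in> perm_cycles (medial_points n) \<sigma>'.
              valence \<sigma>' v (induced_coloring \<alpha>' col))"
proof -
  have \<sigma>: "\<sigma> permutes {1..n}" and \<alpha>: "\<alpha> permutes {1..n}"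
    using assms(1) by (auto simp: planar_hypermap_def hypermap_def hypermap_collection_def)
  have med: "\<sigma>' = medial_vertex_perm n \<alpha>" "\<alpha>' = medial_edge_perm n \<sigma>"
    using assms(2) by (auto simp: medial_map_def)
  have "real m ^ kappa n \<sigma> \<alpha> * whitney n \<sigma> \<alpha> (real m) (real m) =
      (\<Sum>\<beta> | refines n \<beta> \<alpha>. real m ^ num_cycles {1..n} (inv' \<sigma> \<circ> \<beta>))"
    unfolding whitney_def sum_distrib_left
  proof (rule sum.cong)
    fix \<beta> assume "\<beta> \<in> {\<beta>. refines n \<beta> \<alpha>}"
    \<comment> \<open>The terms \<open>kappa n \<sigma> \<alpha>\<close> cancel, and the two
      occurrences of \<open>kappa n \<sigma> \<beta>\<close> make up the doubled component count of
      the genus 0 formula.\<close>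
    then have z: "int (num_cycles {1..n} (inv' \<sigma> \<circ> \<beta>)) = int (kappa n \<sigma> \<alpha>)
      + (int (kappa n \<sigma> \<beta>) - int (kappa n \<sigma> \<alpha>)) + (int (kappa n \<sigma> \<beta>) + int n
                  - int (num_cycles {1..n} \<beta>) - int (num_cycles {1..n} \<sigma>))"
      using planar_refinement_defect[OF assms(1), of \<beta>] by simp
    have "real m ^ num_cycles {1..n} (inv' \<sigma> \<circ> \<beta>) = real m powi int (num_cycles {1..n} (inv' \<sigma> \<circ> \<beta>))"
      by (simp only: power_int_of_nat)
    also have "\<dots> = real m ^ kappa n \<sigma> \<alpha> * (real m powi (int (kappa n \<sigma> \<beta>) - int (kappa n \<sigma> \<alpha>)) *
        real m powi (int (kappa n \<sigma> \<beta>) + int n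
                  - int (num_cycles {1..n} \<beta>) - int (num_cycles {1..n} \<sigma>)))"
      \<comment> \<open>The exponents are integer differences, so splitting the power relies on a
        nonzero base, which \<open>m > 0\<close> supplies.\<close>
      unfolding z using assms(3)
      by (subst power_int_add, simp, subst power_int_add, simp, simp only: power_int_of_nat mult.assoc)
    finally show "real m ^ kappa n \<sigma> \<alpha> * (real m powi (int (kappa n \<sigma> \<beta>) - int (kappa n \<sigma> \<alpha>)) *
        real m powi (int (kappa n \<sigma> \<beta>) + int n
                  - int (num_cycles {1..n} \<beta>) - int (num_cycles {1..n} \<sigma>))) =
        real m ^ num_cycles {1..n} (inv' \<sigma> \<circ> \<beta>)" ..
  qed simp
  then show ?thesis
    unfolding med sum_eulerian_colorings_prod_valence[OF \<sigma> \<alpha>] by simp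
qed

end
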